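(* Let $m\ge 1$, $d\ge 1$, let $R=\sum_{i=0}^d a_ix^{2^i}\in\mathbf{F}_{2^m}[x]$ with $a_d\neq 0$, and set $f(x)=xR(x)$. Let $\widetilde R=\sum_{i=0}^d\left(a_i^{2^d}x^{2^{d+i}}+a_i^{2^{d-i}}x^{2^{d-i}}\right)$ be the kernel polynomial, let $\mathbf{F}_{2^{mN}}$ be its splitting field over $\mathbf{F}_{2^m}$ (so $N$ is the degree of this splitting field over $\mathbf{F}_{2^m}$), and let $D$ be the period of $L(f,T)$. Then $D\in\{N,2N,4N\}$. Precisely: (i) if $\varepsilon_N(f)=-1$, then $D=N$; (ii) if $\varepsilon_N(f)=1$, then $\varepsilon_{2N}(f)=-1$, $D=2N$, and the orders (as roots of unity) of all reciprocal roots of $L^\ast(f,T)$ have $2$-adic valuation $v_2(N)+1$; (iii) if $\varepsilon_N(f)=0$, then one of the following alternatives holds: (iiia) $\varepsilon_{2N}(f)=-1$, and then $D=2N$; (iiib) $\varepsilon_{2N}(f)=1$, and then $D=4N$ and the orders of all reciprocal roots of $L^\ast(f,T)$ have $2$-adic valuation $v_2(N)+2$.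
   Context: For a quadratic form $q$ on a $k$-dimensional $\mathbf{F}_2$-vector space $V$, with polarisation $b(x,y)=q(x+y)+q(x)+q(y)$ whose radical has dimension $c$ (set $r=k-c$), the invariant $\varepsilon(q)\in\{0,1,-1\}$ is defined as follows: $\varepsilon(q)=0$ if $q$ is not identically zero on the radical of $b$ (equivalently $q$ is isometric to $x_1x_2+\cdots+x_{r-1}x_r+x_{r+1}^2$); $\varepsilon(q)=1$ if $q$ is isometric to $x_1x_2+\cdots+x_{r-1}x_r$; $\varepsilon(q)=-1$ if $q$ is isometric to $x_1^2+x_1x_2+x_2^2+x_3x_4+\cdots+x_{r-1}x_r$. One has $\sum_{x\in V}(-1)^{q(x)}=\varepsilon(q)2^{(k+c)/2}$. For $n\ge1$, $q_n=\mathrm{Tr}_{\mathbf{F}_{2^{mn}}/\mathbf{F}_2}\circ f$ is a quadratic form on the $\mathbf{F}_2$-vector space $\mathbf{F}_{2^{mn}}$, and $\varepsilon_n(f):=\varepsilon(q_n)$. Put $S_n(f)=\sum_{x\in\mathbf{F}_{2^{mn}}}(-1)^{\mathrm{Tr}_{\mathbf{F}_{2^{mn}}/\mathbf{F}_2}(f(x))}$, $L(f,T)=\exp\left(\sum_{n\ge1}S_n(f)\frac{T^n}{n}\right)$, and $L^\ast(f,T)=L(f,T/\sqrt2^{\,m})$. It is known that $L^\ast(f,T)=\prod_{i=1}^{2^d}(1-\beta_iT)$ is a polynomial of degree $2^d$ whose reciprocal roots $\beta_i$ are roots of unity. The period $D$ of $L(f,T)$ is the least common multiple of the orders of the $\beta_i$.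 $v_2$ denotes the $2$-adic valuation. *)

theory Defs
  imports
    Complex_Main
    "HOL-Library.Z2"
    "HOL-Library.Function_Algebras"
    "HOL-Computational_Algebra.Computational_Algebra"
    "HOL-Algebra.Algebraic_Closure_Type"
    "HOL-Algebra.Generated_Fields"
begin

section \<open>Quadratic forms over the field with two elements\<close>

text \<open>
  The field \<open>\<F>\<^sub>2\<close> is the type \<^typ>\<open>bit\<close>.  An additive group in which every element is its own
  negative is an \<open>\<F>\<^sub>2\<close>-vector space in exactly one way; its scalar multiplication is \<open>scale2\<close>.
  Finite-dimensional spaces are subspaces \<open>V\<close> of such a group, and a form \<open>q\<close> is only looked at
  on \<open>V\<close>.
\<close>

definition scale2 :: "bit \<Rightarrow> 'v::ab_group_add \<Rightarrow> 'v" where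
  "scale2 c v = (if c = 0 then 0 else v)"

lemma vector_space_scale2:
  assumes "\<And>v :: 'v::ab_group_add. v + v = 0"
  shows "vector_space (scale2 :: bit \<Rightarrow> 'v \<Rightarrow> 'v)"
proof
  fix a b :: bit and x :: 'v
  show "scale2 (a + b) x = scale2 a x + scale2 b x"
    by (cases a; cases b) (simp_all add: scale2_def assms)
qed (auto simp: scale2_def)

definition dim2 :: "'v::ab_group_add set \<Rightarrow> nat" where
  "dim2 V = vector_space.dim (scale2 :: bit \<Rightarrow> 'v \<Rightarrow> 'v) V"

definition isometric ::
  "'v::ab_group_add set \<Rightarrow> ('v \<Rightarrow> bit) \<Rightarrow> 'w::ab_group_add set \<Rightarrow> ('w \<Rightarrow> bit) \<Rightarrow> bool" where
  "isometric V q W p \<longleftrightarrow>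
     (\<exists>\<phi>. bij_betw \<phi> V W \<and>
          (\<forall>x\<in>V. \<forall>y\<in>V. \<phi> (x + y) = \<phi> x + \<phi> y) \<and>
          (\<forall>c. \<forall>x\<in>V. \<phi> (scale2 c x) = scale2 c (\<phi> x)) \<and>
          (\<forall>x\<in>V. p (\<phi> x) = q x))"

definition polarisation :: "('v::ab_group_add \<Rightarrow> bit) \<Rightarrow> 'v \<Rightarrow> 'v \<Rightarrow> bit" where
  "polarisation q x y = q (x + y) + q x + q y"

definition radical :: "'v::ab_group_add set \<Rightarrow> ('v \<Rightarrow> bit) \<Rightarrow> 'v set" where
  "radical V q = {x\<in>V. \<forall>y\<in>V. polarisation q x y = 0}"

text \<open>
  The coordinate space \<open>\<F>\<^sub>2\<^sup>k\<close>, with coordinates numbered from \<open>0\<close>, and the two model forms in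
  the first \<open>r\<close> coordinates, \<open>r\<close> even.
\<close>

definition coord_space :: "nat \<Rightarrow> (nat \<Rightarrow> bit) set" where
  "coord_space k = {x. \<forall>i\<ge>k. x i = 0}"

definition plus_form :: "nat \<Rightarrow> (nat \<Rightarrow> bit) \<Rightarrow> bit" where
  "plus_form r x = (\<Sum>j<r div 2. x (2 * j) * x (2 * j + 1))"

definition minus_form :: "nat \<Rightarrow> (nat \<Rightarrow> bit) \<Rightarrow> bit" where
  "minus_form r x =
     (x 0)\<^sup>2 + x 0 * x 1 + (x 1)\<^sup>2 + (\<Sum>j = 1..<r div 2. x (2 * j) * x (2 * j + 1))"

text \<open>
  The polarisation of a quadratic form is alternating, so \<open>r\<close> is even for every quadratic form;
  \<open>minus_form r\<close> makes sense only for \<open>r \<ge> 2\<close>.  For a quadratic form on a finite space exactly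
  one of the three cases occurs; the value on other functions is left unspecified.
\<close>

definition eps_form :: "'v::ab_group_add set \<Rightarrow> ('v \<Rightarrow> bit) \<Rightarrow> int" where
  "eps_form V q =
     (let k = dim2 V; c = dim2 (radical V q); r = k - c in
      if \<exists>x\<in>radical V q. q x \<noteq> 0 then 0
      else if even r \<and> isometric V q (coord_space k) (plus_form r) then 1
      else if even r \<and> r \<ge> 2 \<and> isometric V q (coord_space k) (minus_form r) then -1
      else undefined)"


section \<open>Finite fields of characteristic two\<close>

text \<open>
  All fields live in one algebraically closed field of characteristic two, which contains for
  each \<open>n \<ge> 1\<close> exactly one subfield with \<open>2\<^sup>n\<close> elements.
\<close>

definition GF2 :: "nat \<Rightarrow> 'a::alg_closed_field set" where
  "GF2 n = {x. x ^ (2 ^ n) = x}"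

text \<open>
  The trace from \<open>GF2 n\<close> to the prime field.  On \<open>GF2 n\<close> the sum of conjugates lies in \<open>{0, 1}\<close>,
  which is identified with \<^typ>\<open>bit\<close>.
\<close>

definition trace2 :: "nat \<Rightarrow> 'a::alg_closed_field \<Rightarrow> bit" where
  "trace2 n x = (if (\<Sum>i<n. x ^ (2 ^ i)) = 0 then 0 else 1)"

definition splitting_field :: "'a::alg_closed_field set \<Rightarrow> 'a poly \<Rightarrow> 'a set" where
  "splitting_field K p = generate_field ring_of_type_algebra (K \<union> {x. poly p x = 0})"

definition R_poly :: "nat \<Rightarrow> (nat \<Rightarrow> 'a::alg_closed_field) \<Rightarrow> 'a poly" where
  "R_poly d a = (\<Sum>i\<le>d. Polynomial.monom (a i) (2 ^ i))"

definition f_poly :: "nat \<Rightarrow> (nat \<Rightarrow> 'a::alg_closed_field) \<Rightarrow> 'a poly" where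
  "f_poly d a = [:0, 1:] * R_poly d a"

definition kernel_poly :: "nat \<Rightarrow> (nat \<Rightarrow> 'a::alg_closed_field) \<Rightarrow> 'a poly" where
  "kernel_poly d a =
     (\<Sum>i\<le>d. Polynomial.monom (a i ^ (2 ^ d)) (2 ^ (d + i)) +
             Polynomial.monom (a i ^ (2 ^ (d - i))) (2 ^ (d - i)))"

definition q_form :: "nat \<Rightarrow> 'a::alg_closed_field poly \<Rightarrow> nat \<Rightarrow> 'a \<Rightarrow> bit" where
  "q_form m f n x = trace2 (m * n) (poly f x)"

definition eps :: "nat \<Rightarrow> 'a::alg_closed_field poly \<Rightarrow> nat \<Rightarrow> int" where
  "eps m f n = eps_form (GF2 (m * n)) (q_form m f n)"


section \<open>The L-function and its period\<close>

definition exp_sum :: "nat \<Rightarrow> 'a::alg_closed_field poly \<Rightarrow> nat \<Rightarrow> complex" where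
  "exp_sum m f n = (\<Sum>x\<in>GF2 (m * n). if q_form m f n x = 0 then 1 else -1)"

definition L_fps :: "nat \<Rightarrow> 'a::alg_closed_field poly \<Rightarrow> complex fps" where
  "L_fps m f =
     fps_compose (fps_exp 1) (Abs_fps (\<lambda>n. if n = 0 then 0 else exp_sum m f n / of_nat n))"

definition Lstar_fps :: "nat \<Rightarrow> 'a::alg_closed_field poly \<Rightarrow> complex fps" where
  "Lstar_fps m f =
     fps_compose (L_fps m f) (fps_const (1 / complex_of_real (sqrt 2) ^ m) * fps_X)"

text \<open>
  For a polynomial power series \<open>\<Prod>i. (1 - \<beta>\<^sub>i T)\<close> with all \<open>\<beta>\<^sub>i \<noteq> 0\<close> this is the set of the \<open>\<beta>\<^sub>i\<close>.
\<close>

definition reciprocal_roots :: "complex fps \<Rightarrow> complex set" where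
  "reciprocal_roots F =
     {\<beta>. \<beta> \<noteq> 0 \<and> (\<exists>p. F = fps_of_poly p \<and> poly p (inverse \<beta>) = 0)}"

definition unity_order :: "complex \<Rightarrow> nat" where
  "unity_order z = (LEAST n. n > 0 \<and> z ^ n = 1)"

definition L_period :: "nat \<Rightarrow> 'a::alg_closed_field poly \<Rightarrow> nat" where
  "L_period m f = Lcm (unity_order ` reciprocal_roots (Lstar_fps m f))"

end

theory Submission
  imports Defs
begin

text \<open>
  Put \<open>s\<^sub>n = S\<^sub>n(f) / 2 ^ (mn / 2)\<close> and let \<open>W\<close> be the set of zeros of the kernel polynomial, a vector
  space of dimension \<open>2d\<close> over \<open>\<F>\<^sub>2\<close>.  The radical of \<open>q\<^sub>n\<close> is the intersection of \<open>W\<close> with the field of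
  \<open>2 ^ (mn)\<close> elements (\<open>radical_q_form\<close>).  The classification of quadratic forms over \<open>\<F>\<^sub>2\<close> evaluates
  the Gauss sum as \<open>s\<^sub>n = \<epsilon>\<^sub>n 2 ^ (c / 2)\<close>, where \<open>c\<close> is the dimension of that radical
  (\<open>eps_form_gauss_sum\<close>, \<open>normalised_sum_cases\<close>).  Hence \<open>|s\<^sub>n| \<le> 2 ^ d\<close>, with equality if and only if
  \<open>\<epsilon>\<^sub>n \<noteq> 0\<close> and \<open>W\<close> lies in that field, that is, \<open>N\<close> divides \<open>n\<close>.

  On the other side, \<open>L\<^sup>*(f, T)\<close> is a polynomial of degree at most \<open>2 ^ d\<close> (\<open>Lstar_polynomial\<close>): \<open>L(f, T)\<close>
  is the L-series of a multiplicative character of the monic polynomials over \<open>GF2 m\<close>, and its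
  coefficients of degree at least \<open>degree f\<close> vanish because the character sums to zero over
  the polynomials that differ in one suitable coefficient only.  So \<open>s\<^sub>n = - \<Sum> \<beta>\<^sub>i ^ n\<close> with at most \<open>2 ^ d\<close>
  reciprocal roots.  Since the \<open>s\<^sub>n\<close> are bounded, \<open>|\<beta>\<^sub>i| \<le> 1\<close> (\<open>bounded_power_sums_imp_norm_le_1\<close>).

  The proposition compares the two sides.  If \<open>N\<close> divides \<open>n\<close> and \<open>\<epsilon>\<^sub>n = \<plusminus>1\<close>, then at most \<open>2 ^ d\<close> numbers
  of the unit disc have sum \<open>\<mp>2 ^ d\<close>, which forces \<open>\<beta>\<^sub>i ^ n = - \<epsilon>\<^sub>n\<close> for all \<open>i\<close>
  (\<open>extremal_sum_imp_all_eq\<close>).  Conversely, if all \<open>\<beta>\<^sub>i ^ n\<close> are 1, then \<open>s\<^sub>n = - 2 ^ d\<close> and \<open>N\<close> divides \<open>n\<close>;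
  so \<open>D\<close> is a multiple of \<open>N\<close>.  If \<open>\<epsilon>\<^sub>N = -1\<close>, then \<open>\<beta>\<^sub>i ^ N = 1\<close> and \<open>D = N\<close>.  If \<open>\<epsilon>\<^sub>N = 1\<close>, then
  \<open>\<beta>\<^sub>i ^ N = -1\<close>, which gives \<open>D = 2 * N\<close>, \<open>\<epsilon>\<^bsub>2N\<^esub> = -1\<close> and the 2-adic valuation of the orders.  If
  \<open>\<epsilon>\<^sub>N = 0\<close>, then \<open>\<epsilon>\<^bsub>2N\<^esub> \<noteq> 0\<close>, because \<open>q\<^bsub>2N\<^esub>\<close> vanishes on \<open>W\<close> (\<open>eps_double_nonzero\<close>), and the same argument
  applies with \<open>2 * N\<close> in place of \<open>N\<close>; here \<open>D \<noteq> N\<close> because \<open>s\<^sub>N = 0\<close>.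
\<close>

section \<open>Quadratic forms over the field with two elements and their Gauss sums\<close>

text \<open>
  The simplifier would otherwise replace the field operations of \<open>bit\<close> by bitwise connectives,
  and the field and linearity laws used below would no longer apply.
\<close>

declare add_bit_eq_xor [simp del] mult_bit_eq_and [simp del]

lemma bit_add_self [simp]: "a + a = (0 :: bit)"
  by (cases a) simp_all

lemma bit_add_eq_0_iff [simp]: "a + b = 0 \<longleftrightarrow> a = (b :: bit)"
  by (cases a; cases b) simp_all

definition bit_sign :: "bit \<Rightarrow> complex" where
  "bit_sign c = (if c = 0 then 1 else -1)"

lemma bit_sign_simps [simp]: "bit_sign 0 = 1" "bit_sign 1 = -1"
  by (simp_all add: bit_sign_def)

lemma bit_sign_add: "bit_sign (a + b) = bit_sign a * bit_sign b"
  by (cases a; cases b) simp_all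

definition gauss_sum :: "'v set \<Rightarrow> ('v \<Rightarrow> bit) \<Rightarrow> complex" where
  "gauss_sum V q = (\<Sum>x\<in>V. bit_sign (q x))"

text \<open>
  Inserting a pair of coordinates at positions \<open>s\<close> and \<open>s + 1\<close> adds a plane to a coordinate
  space.  With \<open>s = r\<close> the new pair follows the \<open>r\<close> coordinates on which a model form of rank \<open>r\<close>
  depends and precedes the coordinates of the radical, so both model forms of rank \<open>r\<close> extend to
  the model form of rank \<open>r + 2\<close> of the same type.
\<close>

definition insert_pair :: "nat \<Rightarrow> bit \<Rightarrow> bit \<Rightarrow> (nat \<Rightarrow> bit) \<Rightarrow> nat \<Rightarrow> bit" where
  "insert_pair s u v x =
     (\<lambda>i. if i < s then x i else if i = s then u else if i = s + 1 then v else x (i - 2))"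

lemma insert_pair_add:
  "insert_pair s (u + u') (v + v') (x + x') = insert_pair s u v x + insert_pair s u' v' x'"
  by (auto simp: insert_pair_def fun_eq_iff)

lemma bij_betw_insert_pair:
  assumes "s \<le> k"
  shows "bij_betw (\<lambda>(u, v, x). insert_pair s u v x) (UNIV \<times> UNIV \<times> coord_space k)
           (coord_space (k + 2))"
proof (rule bij_betw_byWitness[where f' = "\<lambda>y. (y s, y (s + 1), \<lambda>i. if i < s then y i else y (i + 2))"])
  show "\<forall>y\<in>coord_space (k + 2).
      (case (y s, y (s + 1), \<lambda>i. if i < s then y i else y (i + 2)) of
        (u, v, x) \<Rightarrow> insert_pair s u v x) = y"
  proof
    fix y assume "y \<in> coord_space (k + 2)"
    have "i - 2 + 2 = i" "\<not> i - 2 < s" if "\<not> i < s" "i \<noteq> s" "i \<noteq> Suc s" for i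
      using that by linarith+
    thus "(case (y s, y (s + 1), \<lambda>i. if i < s then y i else y (i + 2)) of
        (u, v, x) \<Rightarrow> insert_pair s u v x) = y"
      by (auto simp: insert_pair_def fun_eq_iff)
  qed
  show "\<forall>z\<in>UNIV \<times> UNIV \<times> coord_space k. (\<lambda>y. (y s, y (s + 1), \<lambda>i. if i < s then y i else y (i + 2)))
      ((\<lambda>(u, v, x). insert_pair s u v x) z) = z"
    by (simp add: insert_pair_def fun_eq_iff split_beta)
  have "insert_pair s u v x i = 0" if "x \<in> coord_space k" "i \<ge> k + 2" for u v x i
  proof -
    have "\<not> i < s" "i \<noteq> s" "i \<noteq> s + 1" "k \<le> i - 2" using that(2) assms by linarith+
    thus ?thesis using that(1) by (simp add: insert_pair_def coord_space_def)
  qed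
  thus "(\<lambda>(u, v, x). insert_pair s u v x) ` (UNIV \<times> UNIV \<times> coord_space k) \<subseteq> coord_space (k + 2)"
    by (auto simp: coord_space_def)
  show "(\<lambda>y. (y s, y (s + 1), \<lambda>i. if i < s then y i else y (i + 2))) ` coord_space (k + 2)
      \<subseteq> UNIV \<times> UNIV \<times> coord_space k"
    using assms by (auto simp: coord_space_def)
qed

lemma plus_form_insert_pair:
  "plus_form (2 * t + 2) (insert_pair (2 * t) u v x) = plus_form (2 * t) x + u * v"
proof -
  have "(\<Sum>j<t. insert_pair (2 * t) u v x (2 * j) * insert_pair (2 * t) u v x (2 * j + 1)) =
        (\<Sum>j<t. x (2 * j) * x (2 * j + 1))"
    by (intro sum.cong) (auto simp: insert_pair_def)
  thus ?thesis
    by (simp add: plus_form_def) (simp add: insert_pair_def)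
qed

lemma minus_form_insert_pair:
  assumes "t \<ge> 1"
  shows "minus_form (2 * t + 2) (insert_pair (2 * t) u v x) = minus_form (2 * t) x + u * v"
proof -
  have "(\<Sum>j=1..<t. insert_pair (2 * t) u v x (2 * j) * insert_pair (2 * t) u v x (2 * j + 1)) =
        (\<Sum>j=1..<t. x (2 * j) * x (2 * j + 1))"
    by (intro sum.cong) (auto simp: insert_pair_def)
  moreover have "insert_pair (2 * t) u v x 0 = x 0" "insert_pair (2 * t) u v x 1 = x 1"
    using assms by (auto simp: insert_pair_def)
  ultimately show ?thesis using assms
    by (simp add: minus_form_def add.assoc) (simp add: insert_pair_def)
qed

lemma plus_form_0 [simp]: "plus_form 0 x = 0"
  by (simp add: plus_form_def)

text \<open>
  The anisotropic plane is only ever inserted at position 0, in front of the radical; this starts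
  the forms of minus type.
\<close>

lemma minus_form_2_insert_pair:
  "minus_form 2 (insert_pair 0 u v x) = u + v + u * v"
  by (cases u; cases v) (simp_all add: minus_form_def insert_pair_def)

lemma coord_space_0: "coord_space 0 = {0}"
  by (auto simp: coord_space_def fun_eq_iff)

lemma coord_space_Suc:
  "bij_betw (\<lambda>(u, x). x(k := u)) (UNIV \<times> coord_space k) (coord_space (Suc k))"
proof (rule bij_betw_byWitness[where f' = "\<lambda>y. (y k, y(k := 0))"])
  show "\<forall>z\<in>UNIV \<times> coord_space k. (\<lambda>y. (y k, y(k := 0))) ((\<lambda>(u, x). x(k := u)) z) = z"
    by (simp add: coord_space_def split_beta fun_upd_idem)
  show "\<forall>y\<in>coord_space (Suc k). (\<lambda>(u, x). x(k := u)) ((\<lambda>y. (y k, y(k := 0))) y) = y"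
    by simp
  show "(\<lambda>(u, x). x(k := u)) ` (UNIV \<times> coord_space k) \<subseteq> coord_space (Suc k)"
    by (auto simp: coord_space_def)
  show "(\<lambda>y. (y k, y(k := 0))) ` coord_space (Suc k) \<subseteq> UNIV \<times> coord_space k"
    by (simp add: coord_space_def image_subset_iff)
qed

lemma UNIV_bit: "(UNIV :: bit set) = {0, 1}"
proof -
  have "x \<in> {0, 1}" for x :: bit by (cases x) simp_all
  thus ?thesis by blast
qed

lemma finite_card_coord_space: "finite (coord_space k) \<and> card (coord_space k) = 2 ^ k"
proof (induction k)
  case 0
  thus ?case by (simp add: coord_space_0)
next
  case (Suc k)
  have *: "finite ((UNIV :: bit set) \<times> coord_space k)"
    using Suc by (simp add: UNIV_bit)
  hence "finite (coord_space (Suc k))"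
    using bij_betw_finite[OF coord_space_Suc] by blast
  moreover have "card (coord_space (Suc k)) = card ((UNIV :: bit set) \<times> coord_space k)"
    using bij_betw_same_card[OF coord_space_Suc] by metis
  ultimately show ?case using Suc
    by (simp add: card_cartesian_product UNIV_bit)
qed

text \<open>
  A Gauss sum is multiplicative in orthogonal sums.  The factor of a hyperbolic plane is
  \<open>1 + 1 + 1 - 1 = 2\<close> and that of the anisotropic plane is \<open>1 - 1 - 1 - 1 = -2\<close>; this evaluates the
  sums of the two model forms.
\<close>

lemma gauss_sum_insert_pair:
  assumes "s \<le> k" "\<And>u v x. x \<in> coord_space k \<Longrightarrow> p (insert_pair s u v x) = p' x + g u v"
  shows "gauss_sum (coord_space (k + 2)) p =
           (\<Sum>u\<in>UNIV. \<Sum>v\<in>UNIV. bit_sign (g u v)) * gauss_sum (coord_space k) p'"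
proof -
  have "gauss_sum (coord_space (k + 2)) p =
      (\<Sum>z\<in>UNIV \<times> UNIV \<times> coord_space k. bit_sign (p ((\<lambda>(u, v, x). insert_pair s u v x) z)))"
    unfolding gauss_sum_def
    using sum.reindex_bij_betw[OF bij_betw_insert_pair[OF assms(1)], of "\<lambda>x. bit_sign (p x)"]
    by simp
  also have "\<dots> = (\<Sum>u\<in>UNIV. \<Sum>v\<in>UNIV. \<Sum>x\<in>coord_space k. bit_sign (p (insert_pair s u v x)))"
    by (simp add: sum.cartesian_product case_prod_unfold)
  also have "\<dots> = (\<Sum>u\<in>UNIV. \<Sum>v\<in>UNIV. \<Sum>x\<in>coord_space k. bit_sign (g u v) * bit_sign (p' x))"
    by (intro sum.cong refl) (simp add: assms bit_sign_add)
  finally show ?thesis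
    by (simp only: gauss_sum_def sum_distrib_right) (simp only: sum_distrib_left)
qed

lemma gauss_sum_plus_form:
  "gauss_sum (coord_space (c + 2 * t)) (plus_form (2 * t)) = 2 ^ (c + t)"
proof (induction t)
  case 0
  thus ?case by (simp add: gauss_sum_def finite_card_coord_space)
next
  case (Suc t)
  have "gauss_sum (coord_space (c + 2 * t + 2)) (plus_form (2 * t + 2)) =
      (\<Sum>u\<in>UNIV. \<Sum>v\<in>UNIV. bit_sign (u * v)) * gauss_sum (coord_space (c + 2 * t)) (plus_form (2 * t))"
    by (rule gauss_sum_insert_pair[where s = "2 * t"]) (simp_all add: plus_form_insert_pair[simplified])
  with Suc show ?case by (simp add: UNIV_bit add_ac)
qed

lemma gauss_sum_minus_form:
  assumes "t \<ge> 1"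
  shows "gauss_sum (coord_space (c + 2 * t)) (minus_form (2 * t)) = - (2 ^ (c + t))"
  using assms
proof (induction t rule: dec_induct)
  case base
  have "gauss_sum (coord_space (c + 2)) (minus_form 2) =
      (\<Sum>u\<in>UNIV. \<Sum>v\<in>UNIV. bit_sign (u + v + u * v)) * gauss_sum (coord_space c) (plus_form 0)"
    by (rule gauss_sum_insert_pair[where s = 0]) (simp_all add: minus_form_2_insert_pair)
  thus ?case using gauss_sum_plus_form[of c 0] by (simp add: UNIV_bit)
next
  case (step t)
  have "gauss_sum (coord_space (c + 2 * t + 2)) (minus_form (2 * t + 2)) =
      (\<Sum>u\<in>UNIV. \<Sum>v\<in>UNIV. bit_sign (u * v)) * gauss_sum (coord_space (c + 2 * t)) (minus_form (2 * t))"
    by (rule gauss_sum_insert_pair[where s = "2 * t"]) (use step in \<open>simp_all add: minus_form_insert_pair[simplified]\<close>)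
  with step show ?case by (simp add: UNIV_bit add_ac)
qed

text \<open>
  The two model forms of the same rank have Gauss sums of opposite sign, so by this invariance they
  are not isometric, and on forms that vanish on their radical \<open>eps_form\<close> is the sign of the sum.
\<close>

lemma gauss_sum_isometric:
  assumes "isometric V q W p"
  shows "gauss_sum V q = gauss_sum W p"
proof -
  obtain \<phi> where "bij_betw \<phi> V W" "\<forall>x\<in>V. p (\<phi> x) = q x"
    using assms by (auto simp: isometric_def)
  thus ?thesis
    using sum.reindex_bij_betw[of \<phi> V W "\<lambda>x. bit_sign (p x)"] by (simp add: gauss_sum_def)
qed

text \<open>
  Subspaces of a group of exponent two are just subgroups, and additivity of the polarisation in one
  variable suffices because it is symmetric.
\<close>

locale quadratic_space =
  fixes V :: "'v::ab_group_add set" and q :: "'v \<Rightarrow> bit"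
  assumes exponent_two: "\<And>v :: 'v. v + v = 0"
    and finite_space: "finite V"
    and zero_mem: "0 \<in> V"
    and add_mem: "\<And>x y. x \<in> V \<Longrightarrow> y \<in> V \<Longrightarrow> x + y \<in> V"
    and polar_add: "\<And>x y z. x \<in> V \<Longrightarrow> y \<in> V \<Longrightarrow> z \<in> V \<Longrightarrow>
          polarisation q (x + y) z = polarisation q x z + polarisation q y z"
begin

lemma polar_sym: "polarisation q x y = polarisation q y x"
  by (simp add: polarisation_def add_ac)

lemma polar_add_right:
  "x \<in> V \<Longrightarrow> y \<in> V \<Longrightarrow> z \<in> V \<Longrightarrow>
     polarisation q z (x + y) = polarisation q z x + polarisation q z y"
  using polar_add polar_sym by metis

lemma polar_0 [simp]: "z \<in> V \<Longrightarrow> polarisation q 0 z = 0" "z \<in> V \<Longrightarrow> polarisation q z 0 = 0"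
  using polar_add[of 0 0 z] polar_sym[of 0 z] zero_mem by (auto simp del: bit_add_eq_0_iff)

lemma form_0 [simp]: "q 0 = 0"
  using polar_0(1)[OF zero_mem] by (simp add: polarisation_def)

lemma polar_self [simp]: "polarisation q x x = 0"
  by (simp add: polarisation_def exponent_two)

lemma form_add: "q (x + y) = q x + q y + polarisation q x y"
  by (cases "q (x + y)"; cases "q x"; cases "q y") (simp_all add: polarisation_def)

lemma add_self_left [simp]: "x + (x + y) = (y :: 'v)"
  by (simp add: exponent_two flip: add.assoc)

lemma scale2_mem: "x \<in> V \<Longrightarrow> scale2 c x \<in> V"
  by (simp add: scale2_def zero_mem)

lemma scale2_add: "scale2 (a + b) x = scale2 a x + scale2 b (x :: 'v)"
  by (cases a; cases b) (simp_all add: scale2_def exponent_two)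

lemma polar_scale2:
  "x \<in> V \<Longrightarrow> y \<in> V \<Longrightarrow> polarisation q (scale2 c x) y = c * polarisation q x y"
  by (cases c) (simp_all add: scale2_def)

lemma isometricI:
  assumes "bij_betw \<phi> V W" "\<And>x y. x \<in> V \<Longrightarrow> y \<in> V \<Longrightarrow> \<phi> (x + y) = \<phi> x + \<phi> y"
    "\<And>x. x \<in> V \<Longrightarrow> p (\<phi> x) = q x"
  shows "isometric V q W p"
proof -
  have "\<phi> 0 = 0"
    using assms(2)[of 0 0] zero_mem by simp
  hence "\<phi> (scale2 c x) = scale2 c (\<phi> x)" for c x
    by (simp add: scale2_def)
  thus ?thesis using assms unfolding isometric_def by blast
qed

lemma radical_subset: "radical V q \<subseteq> V"
  by (auto simp: radical_def)

lemma polar_radical: "x \<in> radical V q \<Longrightarrow> y \<in> V \<Longrightarrow> polarisation q x y = 0"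
  by (auto simp: radical_def)

lemma quadratic_space_radical: "quadratic_space (radical V q) q"
proof unfold_locales
  show "finite (radical V q)"
    using finite_subset[OF radical_subset finite_space] .
qed (simp_all add: radical_def exponent_two zero_mem add_mem polar_add)

text \<open>
  A basis identifies \<open>V\<close> with a coordinate space.  The identification goes from coordinates to
  vectors first, where linear independence gives injectivity and spanning gives surjectivity.
\<close>

lemma dim2_bij:
  obtains \<phi> where "bij_betw \<phi> V (coord_space (dim2 V))"
    "\<And>x y. x \<in> V \<Longrightarrow> y \<in> V \<Longrightarrow> \<phi> (x + y) = \<phi> x + \<phi> y"
proof -
  interpret vs: vector_space "scale2 :: bit \<Rightarrow> 'v \<Rightarrow> 'v"
    by (rule vector_space_scale2) (rule exponent_two)
  have sub: "vs.subspace V"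
    by (auto simp: vs.subspace_def zero_mem add_mem scale2_mem)
  obtain B where B: "B \<subseteq> V" "vs.independent B" "V \<subseteq> vs.span B" "card B = vs.dim V"
    using vs.basis_exists .
  have finB: "finite B"
    using B(1) finite_space finite_subset by blast
  have spanB: "vs.span B = V"
    using B sub vs.span_minimal by blast
  define k where "k = dim2 V"
  have k: "card B = k"
    using B by (simp add: k_def dim2_def)
  obtain e where e: "bij_betw e {..<k} B"
    using ex_bij_betw_nat_finite[OF finB] k by (auto simp: atLeast0LessThan)
  define \<psi> where "\<psi> = (\<lambda>x. \<Sum>i<k. scale2 (x i) (e i))"
  have \<psi>_add: "\<psi> (x + y) = \<psi> x + \<psi> y" for x y
    by (simp add: \<psi>_def scale2_add sum.distrib)
  have "inj_on \<psi> (coord_space k)"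
  proof (rule inj_onI)
    fix x y assume xy: "x \<in> coord_space k" "y \<in> coord_space k" "\<psi> x = \<psi> y"
    define w where "w = x + y"
    define u where "u b = w (the_inv_into {..<k} e b)" for b
    have "\<psi> w = 0"
      by (simp add: w_def \<psi>_add xy exponent_two)
    also have "\<psi> w = (\<Sum>i<k. scale2 (u (e i)) (e i))"
      unfolding \<psi>_def using e
      by (intro sum.cong) (auto simp: u_def bij_betw_def the_inv_into_f_f)
    also have "\<dots> = (\<Sum>b\<in>B. scale2 (u b) b)"
      by (rule sum.reindex_bij_betw[OF e])
    finally have "(\<Sum>b\<in>B. scale2 (u b) b) = 0" .
    hence u0: "u b = 0" if "b \<in> B" for b
      using B(2) that vs.dependent_finite[OF finB] by blast
    have "w i = 0" if "i < k" for i
    proof -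
      have "u (e i) = w i"
        using e that by (auto simp: u_def bij_betw_def the_inv_into_f_f)
      moreover have "e i \<in> B"
        using e that by (auto simp: bij_betw_def)
      ultimately show ?thesis using u0 by metis
    qed
    hence "x i = y i" if "i < k" for i
      using that by (auto simp: w_def)
    moreover have "x i = y i" if "i \<ge> k" for i
      using that xy by (auto simp: coord_space_def)
    ultimately show "x = y"
      by (metis ext leI)
  qed
  moreover have "\<psi> ` coord_space k = V"
  proof
    show "\<psi> ` coord_space k \<subseteq> V"
    proof (rule image_subsetI)
      fix x
      have "\<psi> x \<in> vs.span B"
        unfolding \<psi>_def using e by (intro vs.span_sum vs.span_scale vs.span_base) (auto simp: bij_betw_def)
      thus "\<psi> x \<in> V" using spanB by simp
    qed
  next
    show "V \<subseteq> \<psi> ` coord_space k"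
    proof
      fix v assume "v \<in> V"
      then obtain u where u: "v = (\<Sum>b\<in>B. scale2 (u b) b)"
        using spanB vs.span_finite[OF finB] by blast
      define x where "x i = (if i < k then u (e i) else 0)" for i
      have "\<psi> x = (\<Sum>i<k. scale2 (u (e i)) (e i))"
        by (auto simp: \<psi>_def x_def intro!: sum.cong)
      also have "\<dots> = v"
        unfolding u by (rule sum.reindex_bij_betw[OF e])
      finally have "\<psi> x = v" .
      moreover have "x \<in> coord_space k"
        by (auto simp: x_def coord_space_def)
      ultimately show "v \<in> \<psi> ` coord_space k" by blast
    qed
  qed
  ultimately have bij: "bij_betw \<psi> (coord_space k) V"
    by (simp add: bij_betw_def)
  have inv: "bij_betw (inv_into (coord_space k) \<psi>) V (coord_space k)"
    by (rule bij_betw_inv_into[OF bij])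
  show ?thesis
  proof
    show "bij_betw (inv_into (coord_space k) \<psi>) V (coord_space (dim2 V))"
      using inv by (simp add: k_def)
  next
    fix x y assume xy: "x \<in> V" "y \<in> V"
    let ?i = "inv_into (coord_space k) \<psi>"
    have mem: "?i x \<in> coord_space k" "?i y \<in> coord_space k"
      using inv xy bij_betwE by blast+
    have "\<psi> (?i x + ?i y) = x + y"
      using xy bij by (simp add: \<psi>_add bij_betw_inv_into_right)
    moreover have "?i x + ?i y \<in> coord_space k"
      using mem by (auto simp: coord_space_def)
    ultimately show "?i (x + y) = ?i x + ?i y"
      using bij by (metis bij_betw_inv_into_left)
  qed
qed

lemma card_eq_dim2: "card V = 2 ^ dim2 V"
proof -
  obtain \<phi> where "bij_betw \<phi> V (coord_space (dim2 V))"
    using dim2_bij by blast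
  thus ?thesis
    using bij_betw_same_card finite_card_coord_space by metis
qed

text \<open>
  Translation by a vector of the radical on which \<open>q\<close> is 1 negates every summand.
\<close>

lemma gauss_sum_eq_0:
  assumes "z \<in> radical V q" "q z \<noteq> 0"
  shows "gauss_sum V q = 0"
proof -
  have z: "z \<in> V" using assms radical_subset by blast
  have "bij_betw (\<lambda>x. z + x) V V"
    by (rule bij_betw_byWitness[where f' = "\<lambda>x. z + x"]) (use z add_mem in auto)
  hence "gauss_sum V q = (\<Sum>x\<in>V. bit_sign (q (z + x)))"
    using sum.reindex_bij_betw[of "\<lambda>x. z + x" V V "\<lambda>x. bit_sign (q x)"] by (simp add: gauss_sum_def)
  also have "\<dots> = (\<Sum>x\<in>V. - bit_sign (q x))"
    using assms polar_radical[OF assms(1)] by (intro sum.cong) (auto simp: form_add bit_sign_add)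
  also have "\<dots> = - gauss_sum V q"
    by (simp add: gauss_sum_def sum_negf)
  finally show ?thesis by simp
qed

definition perp :: "'v \<Rightarrow> 'v \<Rightarrow> 'v set" where
  "perp e f = {z\<in>V. polarisation q z e = 0 \<and> polarisation q z f = 0}"

lemma quadratic_space_perp:
  assumes "e \<in> V" "f \<in> V"
  shows "quadratic_space (perp e f) q"
proof unfold_locales
  show "finite (perp e f)"
    using finite_space by (auto simp: perp_def)
qed (use assms in \<open>simp_all add: perp_def exponent_two zero_mem add_mem polar_add\<close>)

context
  fixes e f
  assumes e: "e \<in> V" and f: "f \<in> V" and ef: "polarisation q e f = 1"
begin

lemma fe: "polarisation q f e = 1"
  using ef polar_sym by metis

definition proj_perp :: "'v \<Rightarrow> 'v" where
  "proj_perp z = z + (scale2 (polarisation q z f) e + scale2 (polarisation q z e) f)"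

lemma proj_perp_mem: "z \<in> V \<Longrightarrow> proj_perp z \<in> perp e f"
  using e f ef fe
  by (simp add: perp_def proj_perp_def polar_add polar_scale2 add_mem scale2_mem)

text \<open>
  If \<open>b(e, f) = 1\<close>, the plane spanned by \<open>e\<close> and \<open>f\<close> splits off: the \<open>e\<close>-coordinate of \<open>z\<close> is
  \<open>b(z, f)\<close>, the \<open>f\<close>-coordinate is \<open>b(z, e)\<close>, and the rest is orthogonal to the plane.
\<close>

lemma split_plane:
  "bij_betw (\<lambda>z. (polarisation q z f, polarisation q z e, proj_perp z)) V (UNIV \<times> UNIV \<times> perp e f)"
proof (rule bij_betw_byWitness[where f' = "\<lambda>(u, v, w). w + (scale2 u e + scale2 v f)"])
  show "(\<lambda>z. (polarisation q z f, polarisation q z e, proj_perp z)) ` V \<subseteq> UNIV \<times> UNIV \<times> perp e f"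
    using proj_perp_mem by auto
  show "(\<lambda>(u, v, w). w + (scale2 u e + scale2 v f)) ` (UNIV \<times> UNIV \<times> perp e f) \<subseteq> V"
    using e f by (auto simp: perp_def intro!: add_mem scale2_mem)
  show "\<forall>z\<in>V. (\<lambda>(u, v, w). w + (scale2 u e + scale2 v f))
      (polarisation q z f, polarisation q z e, proj_perp z) = z"
    by (simp add: proj_perp_def exponent_two add.assoc)
  have "polarisation q (w + (scale2 u e + scale2 v f)) f = u"
       "polarisation q (w + (scale2 u e + scale2 v f)) e = v" if "w \<in> perp e f" for u v w
    using that e f ef fe by (auto simp: perp_def polar_add polar_scale2 add_mem scale2_mem)
  thus "\<forall>a\<in>UNIV \<times> UNIV \<times> perp e f.
      (\<lambda>z. (polarisation q z f, polarisation q z e, proj_perp z))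
        ((\<lambda>(u, v, w). w + (scale2 u e + scale2 v f)) a) = a"
    by (auto simp: proj_perp_def exponent_two add.assoc)
qed

lemma card_perp: "card V = 4 * card (perp e f)"
  using bij_betw_same_card[OF split_plane] by (simp add: card_cartesian_product UNIV_bit)

lemma radical_perp: "radical (perp e f) q = radical V q"
proof
  show "radical V q \<subseteq> radical (perp e f) q"
    using e f by (auto simp: radical_def perp_def)
  show "radical (perp e f) q \<subseteq> radical V q"
  proof
    fix x assume x: "x \<in> radical (perp e f) q"
    hence xV: "x \<in> V" and xe: "polarisation q x e = 0" "polarisation q x f = 0"
      by (auto simp: radical_def perp_def)
    have "polarisation q x z = 0" if z: "z \<in> V" for z
    proof -
      let ?y = "scale2 (polarisation q z f) e + scale2 (polarisation q z e) f"
      have "polarisation q x (proj_perp z) = 0"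
        using x proj_perp_mem[OF z] by (auto simp: radical_def)
      moreover have "polarisation q x (proj_perp z) = polarisation q x z + polarisation q x ?y"
        unfolding proj_perp_def using z e f xV by (intro polar_add_right add_mem scale2_mem)
      moreover have "polarisation q ?y x = 0"
        using xe e f xV polar_sym[of e x] polar_sym[of f x]
        by (simp add: polar_add polar_scale2 scale2_mem)
      ultimately show ?thesis
        using polar_sym[of x ?y] by simp
    qed
    thus "x \<in> radical V q" using xV by (auto simp: radical_def)
  qed
qed

lemma isometric_split_plane:
  assumes iso: "isometric (perp e f) q (coord_space k) p'" and s: "s \<le> k"
    and p: "\<And>u v x. p (insert_pair s u v x) = p' x + q (scale2 u e + scale2 v f)"
  shows "isometric V q (coord_space (k + 2)) p"
proof -
  obtain \<phi>' where \<phi>': "bij_betw \<phi>' (perp e f) (coord_space k)"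
    "\<And>x y. x \<in> perp e f \<Longrightarrow> y \<in> perp e f \<Longrightarrow> \<phi>' (x + y) = \<phi>' x + \<phi>' y"
    "\<And>x. x \<in> perp e f \<Longrightarrow> p' (\<phi>' x) = q x"
    using iso by (auto simp: isometric_def)
  define \<phi> where
    "\<phi> z = insert_pair s (polarisation q z f) (polarisation q z e) (\<phi>' (proj_perp z))" for z
  have mid: "bij_betw (\<lambda>(u, v, w). (u, v, \<phi>' w)) ((UNIV :: bit set) \<times> (UNIV :: bit set) \<times> perp e f)
      (UNIV \<times> UNIV \<times> coord_space k)"
    by (rule bij_betw_byWitness[where f' = "\<lambda>(u, v, w). (u, v, inv_into (perp e f) \<phi>' w)"])
       (use bij_betw_inv_into_left[OF \<phi>'(1)] bij_betw_inv_into_right[OF \<phi>'(1)] 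
          bij_betwE[OF \<phi>'(1)] bij_betwE[OF bij_betw_inv_into[OF \<phi>'(1)]] in auto)
  have bij: "bij_betw \<phi> V (coord_space (k + 2))"
    using bij_betw_trans[OF bij_betw_trans[OF split_plane mid] bij_betw_insert_pair[OF s]]
    by (simp add: o_def \<phi>_def[abs_def])
  have add: "\<phi> (x + y) = \<phi> x + \<phi> y" if xy: "x \<in> V" "y \<in> V" for x y
  proof -
    have "proj_perp (x + y) = proj_perp x + proj_perp y"
      using xy e f by (simp add: proj_perp_def polar_add scale2_add add_ac)
    thus ?thesis
      using xy e f \<phi>'(2)[OF proj_perp_mem proj_perp_mem]
      by (simp add: \<phi>_def polar_add flip: insert_pair_add)
  qed
  have form: "p (\<phi> z) = q z" if z: "z \<in> V" for z
  proof -
    let ?y = "scale2 (polarisation q z f) e + scale2 (polarisation q z e) f"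
    have y: "?y \<in> V" using e f by (intro add_mem scale2_mem)
    have w: "proj_perp z \<in> V" "polarisation q (proj_perp z) e = 0" "polarisation q (proj_perp z) f = 0"
      using proj_perp_mem[OF z] by (auto simp: perp_def)
    have "polarisation q ?y (proj_perp z) = 0"
      using w e f polar_sym[of e "proj_perp z"] polar_sym[of f "proj_perp z"]
      by (simp add: polar_add polar_scale2 scale2_mem)
    hence "q (proj_perp z + ?y) = q (proj_perp z) + q ?y"
      using polar_sym[of ?y "proj_perp z"] form_add[of "proj_perp z" ?y] by simp
    moreover have "proj_perp z + ?y = z"
      by (simp add: proj_perp_def exponent_two add.assoc)
    ultimately show ?thesis
      using \<phi>'(3)[OF proj_perp_mem[OF z]] by (simp add: \<phi>_def p)
  qed
  show ?thesis
  proof (rule isometricI)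
    show "bij_betw \<phi> V (coord_space (k + 2))" by (rule bij)
    show "\<And>x y. x \<in> V \<Longrightarrow> y \<in> V \<Longrightarrow> \<phi> (x + y) = \<phi> x + \<phi> y" by (rule add)
    show "\<And>x. x \<in> V \<Longrightarrow> p (\<phi> x) = q x" by (rule form)
  qed
qed

end

end

text \<open>
  Induction on the size of the space.  If some vector outside the radical is isotropic, it lies in a
  hyperbolic plane; the plane is split off and inserted behind the model form of its complement.  If
  no vector outside the radical is isotropic, then the rank is 0 or 2: given a plane spanned by \<open>w0\<close>
  and \<open>f\<close>, a vector \<open>x\<close> orthogonal to both and outside the radical would make \<open>x + w0\<close> an isotropic
  vector outside the radical.  Choosing the anisotropic plane last means that two anisotropic planes
  never have to be exchanged for two hyperbolic ones.
\<close>

lemma quadratic_form_classification: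
  assumes "quadratic_space V q" "\<And>x. x \<in> radical V q \<Longrightarrow> q x = 0"
  shows "\<exists>c t. card V = 2 ^ (c + 2 * t) \<and> card (radical V q) = 2 ^ c \<and>
           (isometric V q (coord_space (c + 2 * t)) (plus_form (2 * t)) \<or>
            t \<ge> 1 \<and> isometric V q (coord_space (c + 2 * t)) (minus_form (2 * t)))"
  using assms
proof (induction "card V" arbitrary: V rule: less_induct)
  case (less V)
  interpret quadratic_space V q by fact
  show ?case
  proof (cases "radical V q = V")
    case True
    have zero: "q x = 0" if "x \<in> V" for x
      using less.prems(2) True that by blast
    obtain \<phi> where \<phi>: "bij_betw \<phi> V (coord_space (dim2 V))"
      "\<And>x y. x \<in> V \<Longrightarrow> y \<in> V \<Longrightarrow> \<phi> (x + y) = \<phi> x + \<phi> y"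
      using dim2_bij by blast
    have "isometric V q (coord_space (dim2 V)) (plus_form 0)"
      by (rule isometricI[OF \<phi>]) (simp_all add: zero)
    thus ?thesis
      using True card_eq_dim2 by (intro exI[of _ "dim2 V"] exI[of _ 0]) simp
  next
    case False
    then obtain w0 where w0: "w0 \<in> V" "w0 \<notin> radical V q"
      using radical_subset by blast
    have smaller: "card (perp e f) < card V" 
      if "e \<in> V" "f \<in> V" "polarisation q e f = 1" for e f
    proof -
      have "card V > 0" using zero_mem finite_space card_gt_0_iff by blast
      thus ?thesis using card_perp[OF that] by linarith
    qed
    have IH: "\<exists>c t. card (perp e f) = 2 ^ (c + 2 * t) \<and> card (radical V q) = 2 ^ c \<and>
           (isometric (perp e f) q (coord_space (c + 2 * t)) (plus_form (2 * t)) \<or>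
            t \<ge> 1 \<and> isometric (perp e f) q (coord_space (c + 2 * t)) (minus_form (2 * t)))"
      if "e \<in> V" "f \<in> V" "polarisation q e f = 1" for e f
      using less.hyps[OF smaller[OF that] quadratic_space_perp[OF that(1,2)]]
        less.prems(2) radical_perp[OF that] by simp
    show ?thesis
    proof (cases "\<exists>e\<in>V. e \<notin> radical V q \<and> q e = 0")
      case True
      then obtain e f' where e: "e \<in> V" "q e = 0" and f': "f' \<in> V" "polarisation q e f' = 1"
        by (auto simp: radical_def)
      \<comment> \<open>Adding \<open>e\<close> if necessary makes the partner of \<open>e\<close> isotropic as well.\<close>
      define f where "f = f' + scale2 (q f') e"
      have f: "f \<in> V" "polarisation q e f = 1"
        using e f' by (auto simp: f_def scale2_def intro: add_mem simp: polar_add_right)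
      have qf: "q f = 0"
        using e f' polar_sym[of e f'] by (cases "q f'") (simp_all add: f_def scale2_def form_add)
      obtain c t where ct: "card (perp e f) = 2 ^ (c + 2 * t)" "card (radical V q) = 2 ^ c"
        "isometric (perp e f) q (coord_space (c + 2 * t)) (plus_form (2 * t)) \<or>
         t \<ge> 1 \<and> isometric (perp e f) q (coord_space (c + 2 * t)) (minus_form (2 * t))"
        using IH[OF e(1) f] by blast
      have quv: "q (scale2 u e + scale2 v f) = u * v" for u v
        using e f qf by (cases u; cases v) (simp_all add: scale2_def form_add)
      from ct(3) have "isometric V q (coord_space (c + 2 * t + 2)) (plus_form (2 * t + 2)) \<or>
         isometric V q (coord_space (c + 2 * t + 2)) (minus_form (2 * t + 2))"
      proof (elim disjE conjE)
        assume "isometric (perp e f) q (coord_space (c + 2 * t)) (plus_form (2 * t))"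
        hence "isometric V q (coord_space (c + 2 * t + 2)) (plus_form (2 * t + 2))"
          by (rule isometric_split_plane[OF e(1) f, where s = "2 * t"])
             (simp_all only: plus_form_insert_pair quv le_add2)
        thus ?thesis ..
      next
        assume t: "t \<ge> 1" "isometric (perp e f) q (coord_space (c + 2 * t)) (minus_form (2 * t))"
        from t(2) have "isometric V q (coord_space (c + 2 * t + 2)) (minus_form (2 * t + 2))"
          by (rule isometric_split_plane[OF e(1) f, where s = "2 * t"])
             (simp_all only: minus_form_insert_pair[OF t(1)] quv le_add2)
        thus ?thesis ..
      qed
      thus ?thesis
        using ct card_perp[OF e(1) f] by (intro exI[of _ c] exI[of _ "t + 1"]) simp
    next
      case False
      hence aniso: "q x = 1" if "x \<in> V" "x \<notin> radical V q" for x
        using that by auto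
      obtain f where f: "f \<in> V" "polarisation q w0 f = 1"
        using w0 by (auto simp: radical_def)
      have nonrad: "f \<notin> radical V q"
        using f w0 polar_sym[of w0 f] by (auto simp: radical_def)
      have perp_rad: "perp w0 f \<subseteq> radical V q"
      proof
        fix x assume x: "x \<in> perp w0 f"
        show "x \<in> radical V q"
        proof (rule ccontr)
          assume n: "x \<notin> radical V q"
          have xV: "x \<in> V" "polarisation q x w0 = 0" "polarisation q x f = 0"
            using x by (auto simp: perp_def)
          have "polarisation q (x + w0) f = 1"
            using xV w0 f by (simp add: polar_add)
          hence "x + w0 \<notin> radical V q"
            using f by (auto simp: radical_def)
          hence "q (x + w0) = 1"
            using aniso add_mem xV w0 by blast
          thus False
            using form_add[of x w0] xV w0 aniso n by simp
        qed
      qed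
      obtain c t where ct: "card (perp w0 f) = 2 ^ (c + 2 * t)" "card (radical V q) = 2 ^ c"
        using IH[OF w0(1) f] by blast
      have "card (perp w0 f) \<le> card (radical V q)"
        using perp_rad finite_subset[OF radical_subset finite_space] card_mono by blast
      hence "(2::nat) ^ (c + 2 * t) \<le> 2 ^ c"
        using ct by simp
      hence t: "t = 0"
        by simp
      interpret P: quadratic_space "perp w0 f" q
        by (rule quadratic_space_perp[OF w0(1) f(1)])
      have "dim2 (perp w0 f) = c"
        using P.card_eq_dim2 ct t by simp
      then obtain \<phi> where "bij_betw \<phi> (perp w0 f) (coord_space c)"
        "\<And>x y. x \<in> perp w0 f \<Longrightarrow> y \<in> perp w0 f \<Longrightarrow> \<phi> (x + y) = \<phi> x + \<phi> y"
        using P.dim2_bij by blast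
      hence iso: "isometric (perp w0 f) q (coord_space c) (plus_form 0)"
        using less.prems(2) perp_rad by (intro P.isometricI) auto
      have "q (scale2 u w0 + scale2 v f) = u + v + u * v" for u v
        using aniso[OF w0] aniso[OF f(1) nonrad] f(2)
        by (cases u; cases v) (simp_all add: scale2_def form_add)
      hence "isometric V q (coord_space (c + 2)) (minus_form 2)"
        using isometric_split_plane[OF w0(1) f iso, of 0 "minus_form 2"]
        by (simp add: minus_form_2_insert_pair)
      thus ?thesis
        using ct t card_perp[OF w0(1) f] by (intro exI[of _ c] exI[of _ 1]) simp
    qed
  qed
qed

text \<open>
  The value of the Gauss sum in terms of \<open>\<epsilon>\<close>.  This also shows that \<open>\<epsilon>\<close> is always one of
  0, 1 and -1, since the classification excludes the unspecified case of its definition.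
\<close>

theorem (in quadratic_space) eps_form_gauss_sum:
  obtains (degenerate) x where "x \<in> radical V q" "q x \<noteq> 0" "eps_form V q = 0" "gauss_sum V q = 0"
  | (nondegenerate) c t where "\<And>x. x \<in> radical V q \<Longrightarrow> q x = 0"
      "card V = 2 ^ (c + 2 * t)" "card (radical V q) = 2 ^ c"
      "eps_form V q = 1 \<or> eps_form V q = -1"
      "gauss_sum V q = of_int (eps_form V q) * 2 ^ (c + t)"
proof (cases "\<exists>x\<in>radical V q. q x \<noteq> 0")
  case True
  then obtain x where x: "x \<in> radical V q" "q x \<noteq> 0" by blast
  moreover have "eps_form V q = 0"
    unfolding eps_form_def Let_def using True by (simp only: if_True)
  ultimately show ?thesis
    using degenerate gauss_sum_eq_0 by blast
next
  case False
  hence zero: "\<And>x. x \<in> radical V q \<Longrightarrow> q x = 0" by blast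
  obtain c t where ct: "card V = 2 ^ (c + 2 * t)" "card (radical V q) = 2 ^ c"
    and iso: "isometric V q (coord_space (c + 2 * t)) (plus_form (2 * t)) \<or>
       t \<ge> 1 \<and> isometric V q (coord_space (c + 2 * t)) (minus_form (2 * t))"
    using quadratic_form_classification[OF quadratic_space_axioms zero] by blast
  have dims: "dim2 V = c + 2 * t" "dim2 (radical V q) = c"
    using card_eq_dim2 quadratic_space.card_eq_dim2[OF quadratic_space_radical] ct by simp_all
  have eps: "eps_form V q =
    (if isometric V q (coord_space (c + 2 * t)) (plus_form (2 * t)) then 1
     else if 2 * t \<ge> 2 \<and> isometric V q (coord_space (c + 2 * t)) (minus_form (2 * t)) then -1
     else undefined)"
    using False by (auto simp: eps_form_def dims Let_def)
  show ?thesis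
  proof (cases "isometric V q (coord_space (c + 2 * t)) (plus_form (2 * t))")
    case True
    thus ?thesis
      using nondegenerate[OF zero ct] gauss_sum_isometric[OF True] eps gauss_sum_plus_form by auto
  next
    case False
    hence t: "t \<ge> 1" and min: "isometric V q (coord_space (c + 2 * t)) (minus_form (2 * t))"
      using iso by auto
    thus ?thesis
      using nondegenerate[OF zero ct] gauss_sum_isometric[OF min] eps False gauss_sum_minus_form[OF t]
      by auto
  qed
qed

section \<open>Finite subfields of an algebraically closed field of characteristic two\<close>

text \<open>
  A double root of \<open>p\<close> would be a root of the derivative.
\<close>

lemma card_roots_eq_degree:
  fixes p :: "'a :: alg_closed_field poly"
  assumes "\<And>x. poly p x = 0 \<Longrightarrow> poly (pderiv p) x \<noteq> 0"
  shows "card {x. poly p x = 0} = degree p"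
proof (cases "p = 0")
  case True
  thus ?thesis using assms[of 0] by simp
next
  case False
  obtain A where A: "size A = degree p" "p = smult (lead_coeff p) (\<Prod>x\<in>#A. [:-x, 1:])"
    using alg_closed_imp_factorization[OF False] by blast
  have roots: "poly p x = 0 \<longleftrightarrow> x \<in># A" for x
    using False by (subst A(2)) (auto simp: poly_prod_mset prod_mset_zero_iff)
  have "count A x \<le> 1" for x
  proof (rule ccontr)
    assume "\<not> count A x \<le> 1"
    hence "{#x, x#} \<subseteq># A"
      by (intro mset_subset_eqI) auto
    then obtain B where B: "A = {#x, x#} + B"
      by (metis subset_mset.add_diff_inverse)
    have p: "p = [:-x, 1:] * ([:-x, 1:] * smult (lead_coeff p) (\<Prod>x\<in>#B. [:-x, 1:]))"
      by (subst A(2)) (simp only: B image_mset_union prod_mset.union image_mset_add_mset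
          prod_mset.add_mset image_mset_empty prod_mset.empty mult_1_right mult_smult_right mult.assoc)
    have "poly (pderiv p) x = 0"
      by (subst p) (simp only: pderiv_mult poly_add poly_mult, simp)
    moreover have "poly p x = 0"
      by (subst p) simp
    ultimately show False using assms by blast
  qed
  hence one: "count A x = 1" if "x \<in># A" for x
    using that by (simp add: le_antisym Suc_le_eq)
  have "size A = (\<Sum>x\<in>set_mset A. 1)"
    unfolding size_multiset_overloaded_eq by (intro sum.cong) (simp_all add: one)
  hence "size A = card (set_mset A)"
    by simp
  thus ?thesis using A(1) roots by simp
qed

lemma proots_linear_factors:
  "proots (\<Prod>x\<in>#A. [:-x, 1:] :: 'a :: idom poly) = A"
proof (induction A)
  case (add x A)
  have "(\<Prod>x\<in>#A. [:-x, 1:]) \<noteq> (0 :: 'a poly)"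
    by (auto simp: prod_mset_zero_iff)
  thus ?case using add by (simp add: proots_mult del: mult_pCons_left)
qed simp

lemma sum_order_eq_degree:
  fixes p :: "'a :: alg_closed_field poly"
  assumes "p \<noteq> 0"
  shows "(\<Sum>x | poly p x = 0. order x p) = degree p"
proof -
  obtain A where A: "size A = degree p" "p = smult (lead_coeff p) (\<Prod>x\<in>#A. [:-x, 1:])"
    using alg_closed_imp_factorization[OF assms] by blast
  have "proots p = A"
    using proots_linear_factors[of A] assms by (subst A(2)) simp
  hence "(\<Sum>x\<in>set_mset (proots p). count (proots p) x) = degree p"
    using A(1) by (simp add: size_multiset_overloaded_eq)
  thus ?thesis using assms by simp
qed

locale alg_closed_char_two =
  fixes ty :: "'a::alg_closed_field itself"
  assumes char2: "CHAR('a) = 2"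
begin

lemma two_eq_0: "(2 :: 'a) = 0"
  using of_nat_CHAR[where 'a = 'a] by (simp add: char2)

lemma add_self [simp]: "x + x = (0 :: 'a)"
  by (simp add: two_eq_0 flip: mult_2)

lemma uminus_eq: "- x = (x :: 'a)"
  by (rule minus_unique) (rule add_self)

lemma add_eq_0_iff_eq [simp]: "x + y = 0 \<longleftrightarrow> x = (y :: 'a)"
  using add_eq_0_iff[of x y] by (auto simp: uminus_eq)

lemma power_add_frob: "(x + y :: 'a) ^ (2 ^ n) = x ^ (2 ^ n) + y ^ (2 ^ n)"
  by (rule freshmans_dream') (simp_all add: char2)

lemma power_sum_frob: "(sum g A :: 'a) ^ (2 ^ n) = (\<Sum>i\<in>A. g i ^ (2 ^ n))"
  by (rule freshmans_dream_sum') (simp_all add: char2)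

lemma power_inj_frob: "(x :: 'a) ^ (2 ^ n) = y ^ (2 ^ n) \<longleftrightarrow> x = y"
proof
  assume "x ^ (2 ^ n) = y ^ (2 ^ n)"
  hence "(x + y) ^ (2 ^ n) = 0"
    by (simp add: power_add_frob)
  thus "x = y" by simp
qed simp

lemma GF2_0 [simp]: "(0 :: 'a) \<in> GF2 n"
  by (simp add: GF2_def power_0_left)

lemma GF2_1 [simp]: "(1 :: 'a) \<in> GF2 n"
  by (simp add: GF2_def)

lemma GF2_add: "(x :: 'a) \<in> GF2 n \<Longrightarrow> y \<in> GF2 n \<Longrightarrow> x + y \<in> GF2 n"
  by (simp add: GF2_def power_add_frob)

lemma GF2_mult: "(x :: 'a) \<in> GF2 n \<Longrightarrow> y \<in> GF2 n \<Longrightarrow> x * y \<in> GF2 n"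
  by (simp add: GF2_def power_mult_distrib)

lemma GF2_inverse: "(x :: 'a) \<in> GF2 n \<Longrightarrow> inverse x \<in> GF2 n"
  by (simp add: GF2_def power_inverse)

lemma GF2_power: "(x :: 'a) \<in> GF2 n \<Longrightarrow> x ^ k \<in> GF2 n"
  by (induction k) (auto simp: GF2_mult)

lemma GF2_sum: "(\<And>i. i \<in> A \<Longrightarrow> g i \<in> GF2 n) \<Longrightarrow> (sum g A :: 'a) \<in> GF2 n"
  by (induction A rule: infinite_finite_induct) (auto simp: GF2_add)

lemma GF2_roots:
  "GF2 n = {x :: 'a. poly (Polynomial.monom 1 (2 ^ n) + [:0, 1:]) x = 0}"
  by (auto simp: GF2_def poly_monom)

lemma degree_GF2_poly:
  assumes "n \<ge> 1"
  shows "degree (Polynomial.monom 1 (2 ^ n) + [:0, 1:] :: 'a poly) = 2 ^ n"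
proof -
  have "(2 :: nat) ^ 1 \<le> 2 ^ n" using assms by (intro power_increasing) auto
  thus ?thesis by (subst degree_add_eq_left) (auto simp: degree_monom_eq)
qed

lemma card_GF2:
  assumes "n \<ge> 1"
  shows "card (GF2 n :: 'a set) = 2 ^ n"
proof -
  let ?p = "Polynomial.monom 1 (2 ^ n) + [:0, 1:] :: 'a poly"
  have "pderiv ?p = 1"
    using assms by (simp add: pderiv_add pderiv_monom pderiv_pCons two_eq_0 power_0_left one_pCons)
  hence "card {x. poly ?p x = 0} = degree ?p"
    by (intro card_roots_eq_degree) simp
  thus ?thesis
    using degree_GF2_poly[OF assms] by (simp add: GF2_roots)
qed

lemma finite_GF2: "n \<ge> 1 \<Longrightarrow> finite (GF2 n :: 'a set)"
  using card_GF2[of n] by (metis card.infinite power_eq_0_iff zero_neq_numeral)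

lemma GF2_iterate:
  assumes "(x :: 'a) \<in> GF2 n"
  shows "x ^ (2 ^ (n * k)) = x"
proof (induction k)
  case (Suc k)
  have "x ^ (2 ^ (n * Suc k)) = (x ^ (2 ^ n)) ^ (2 ^ (n * k))"
    by (simp add: power_add mult.commute flip: power_mult)
  also have "\<dots> = x" using assms Suc by (simp add: GF2_def)
  finally show ?case .
qed simp

lemma GF2_mono: "k dvd n \<Longrightarrow> GF2 k \<subseteq> (GF2 n :: 'a set)"
  using GF2_iterate by (auto simp: GF2_def elim!: dvdE)

text \<open>
  The exponents \<open>n\<close> for which \<open>x\<close> is fixed by the \<open>n\<close>-fold Frobenius map are closed under
  Euclidean division.  Comparing cardinalities, this turns an inclusion of finite fields into a
  divisibility.
\<close>

lemma GF2_gcd: "(x :: 'a) \<in> GF2 k \<Longrightarrow> x \<in> GF2 l \<Longrightarrow> x \<in> GF2 (gcd k l)"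
proof (induction k l rule: gcd_nat_induct)
  case (step k l)
  have "x ^ (2 ^ k) = (x ^ (2 ^ (l * (k div l)))) ^ (2 ^ (k mod l))"
    by (simp flip: power_mult power_add)
  hence "x ^ (2 ^ (k mod l)) = x"
    using GF2_iterate[OF step.prems(2)] step.prems(1) by (simp add: GF2_def)
  hence "x \<in> GF2 (gcd l (k mod l))"
    using step by (simp add: GF2_def)
  thus ?case by (simp add: gcd_red_nat[of k l])
qed simp

lemma GF2_subset_imp_dvd:
  assumes "k \<ge> 1" "l \<ge> 1" "GF2 k \<subseteq> (GF2 l :: 'a set)"
  shows "k dvd l"
proof -
  have g: "gcd k l \<ge> 1" using assms(1) by (simp add: Suc_le_eq)
  have "GF2 k \<subseteq> (GF2 (gcd k l) :: 'a set)"
    using assms(3) GF2_gcd by blast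
  hence "card (GF2 k :: 'a set) \<le> card (GF2 (gcd k l) :: 'a set)"
    using finite_GF2[OF g] card_mono by blast
  hence "k \<le> gcd k l"
    using card_GF2[OF assms(1)] card_GF2[OF g] by simp
  moreover have "gcd k l \<le> k"
    using assms(1) by (intro dvd_imp_le) auto
  ultimately have "gcd k l = k" by simp
  thus ?thesis by (metis gcd_dvd2)
qed

lemma bij_betw_frob_GF2:
  assumes "n \<ge> 1"
  shows "bij_betw (\<lambda>x. x ^ (2 ^ j)) (GF2 n) (GF2 n :: 'a set)"
proof -
  have inj: "inj_on (\<lambda>x :: 'a. x ^ (2 ^ j)) (GF2 n)"
    by (auto simp: inj_on_def power_inj_frob)
  have "(\<lambda>x :: 'a. x ^ (2 ^ j)) ` GF2 n = GF2 n"
    using inj GF2_power by (intro endo_inj_surj finite_GF2 assms) auto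
  thus ?thesis using inj by (simp add: bij_betw_def)
qed

text \<open>
  The trace before its values 0 and 1 are read as elements of \<open>bit\<close>.
\<close>

definition tr :: "nat \<Rightarrow> 'a \<Rightarrow> 'a" where
  "tr n x = (\<Sum>i<n. x ^ (2 ^ i))"

lemma trace2_tr: "trace2 n x = (if tr n x = 0 then 0 else 1)"
  by (simp add: trace2_def tr_def)

lemma tr_add: "tr n (x + y) = tr n x + tr n y"
  by (simp add: tr_def power_add_frob sum.distrib)

lemma tr_square:
  assumes "x \<in> GF2 n"
  shows "tr n x ^ 2 = tr n x"
proof -
  have "tr n x ^ 2 = (\<Sum>i<n. x ^ (2 ^ Suc i))"
    using power_sum_frob[of "\<lambda>i. x ^ (2 ^ i)" "{..<n}" 1]
    by (simp add: tr_def mult.commute flip: power_mult)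
  also have "\<dots> + x ^ (2 ^ 0) = tr n x + x ^ (2 ^ n)"
    using sum.lessThan_Suc[of "\<lambda>i. x ^ (2 ^ i)" n]
      sum.lessThan_Suc_shift[of "\<lambda>i. x ^ (2 ^ i)" n] by (simp add: tr_def add.commute)
  finally show ?thesis
    using assms by (simp add: GF2_def)
qed

lemma tr_cases: "x \<in> GF2 n \<Longrightarrow> tr n x = 0 \<or> tr n x = 1"
  using tr_square[of x n] by (simp add: power2_eq_square)

lemma trace2_0 [simp]: "trace2 n (0 :: 'a) = 0"
  by (simp add: trace2_def power_0_left)

lemma trace2_add:
  assumes "(x :: 'a) \<in> GF2 n" "y \<in> GF2 n"
  shows "trace2 n (x + y) = trace2 n x + trace2 n y"
  using tr_cases[OF assms(1)] tr_cases[OF assms(2)]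
  by (auto simp: trace2_tr tr_add)

lemma trace2_sum:
  assumes "\<And>i. i \<in> A \<Longrightarrow> g i \<in> (GF2 n :: 'a set)"
  shows "trace2 n (sum g A) = (\<Sum>i\<in>A. trace2 n (g i))"
  using assms
  by (induction A rule: infinite_finite_induct) (auto simp: trace2_add GF2_sum)

lemma trace2_frob:
  assumes "(x :: 'a) \<in> GF2 n"
  shows "trace2 n (x ^ (2 ^ j)) = trace2 n x"
proof -
  have "tr n (x ^ (2 ^ j)) = tr n x ^ (2 ^ j)"
    unfolding tr_def power_sum_frob by (simp add: mult.commute flip: power_mult)
  thus ?thesis using tr_cases[OF assms] by (auto simp: trace2_tr power_0_left)
qed

text \<open>
  The trace is given by a polynomial of degree \<open>2 ^ (n - 1)\<close>, so it cannot vanish at all the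
  \<open>2 ^ n\<close> elements of the field.
\<close>

lemma trace2_surj:
  assumes "n \<ge> 1"
  obtains x :: 'a where "x \<in> GF2 n" "trace2 n x = 1"
proof -
  define p :: "'a poly" where "p = (\<Sum>i<n. Polynomial.monom 1 (2 ^ i))"
  have p: "poly p x = tr n x" for x
    by (simp add: p_def tr_def poly_sum poly_monom)
  have "coeff p 1 = 1"
  proof -
    have "coeff p 1 = (\<Sum>i<n. if i = 0 then 1 else 0)"
      unfolding p_def coeff_sum by (intro sum.cong) (auto simp: coeff_monom)
    thus ?thesis using assms by simp
  qed
  hence p0: "p \<noteq> 0" by auto
  have "degree p \<le> 2 ^ (n - 1)"
    unfolding p_def
    by (intro degree_sum_le) (auto intro!: order_trans[OF degree_monom_le] power_increasing)
  moreover have "(2::nat) ^ (n - 1) < 2 ^ n"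
    using assms by (intro power_strict_increasing) auto
  ultimately have deg: "degree p < card (GF2 n :: 'a set)"
    unfolding card_GF2[OF assms] by (rule le_less_trans)
  have "\<not> GF2 n \<subseteq> {x. poly p x = 0}"
    using card_mono[OF poly_roots_finite[OF p0], of "GF2 n"] card_poly_roots_bound[OF p0] deg
    by linarith
  then obtain x where "x \<in> GF2 n" "tr n x \<noteq> 0"
    using p by auto
  thus ?thesis using that by (simp add: trace2_tr)
qed

lemma trace2_nondegenerate:
  assumes "n \<ge> 1" "(z :: 'a) \<in> GF2 n" "z \<noteq> 0"
  obtains y where "y \<in> GF2 n" "trace2 n (y * z) = 1"
proof -
  obtain x :: 'a where x: "x \<in> GF2 n" "trace2 n x = 1"
    using trace2_surj[OF assms(1)] .
  show ?thesis
    using x assms by (intro that[of "x * inverse z"]) (auto intro: GF2_mult GF2_inverse simp: mult.assoc)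
qed

text \<open>
  Transitivity of the trace in the tower \<open>\<F>\<^sub>2\<close>, \<open>GF2 m\<close>, \<open>GF2 (m * k)\<close>: the powers of the Frobenius
  map are grouped into blocks of length \<open>m\<close>.
\<close>

lemma trace2_trans:
  "trace2 m (\<Sum>j<k. (x :: 'a) ^ (2 ^ (m * j))) = trace2 (m * k) x"
proof -
  have "tr m (\<Sum>j<k. x ^ (2 ^ (m * j))) = (\<Sum>i<m. \<Sum>j<k. x ^ (2 ^ (j * m + i)))"
    unfolding tr_def power_sum_frob
    by (simp add: power_add mult.commute flip: power_mult)
  also have "\<dots> = (\<Sum>j<k. \<Sum>i<m. x ^ (2 ^ (j * m + i)))"
    by (rule sum.swap)
  also have "\<dots> = (\<Sum>j<k. \<Sum>i=j * m..<j * m + m. x ^ (2 ^ i))"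
  proof (rule sum.cong)
    fix j
    show "(\<Sum>i<m. x ^ (2 ^ (j * m + i))) = (\<Sum>i=j * m..<j * m + m. x ^ (2 ^ i))"
      using sum.shift_bounds_nat_ivl[of "\<lambda>i. x ^ (2 ^ i)" 0 "j * m" m]
      by (simp add: atLeast0LessThan add.commute)
  qed simp
  also have "\<dots> = (\<Sum>i<k * m. x ^ (2 ^ i))"
    by (rule sum.nat_group)
  finally show ?thesis
    by (simp add: trace2_tr tr_def mult.commute)
qed

text \<open>
  On the subfield of index two the trace is twice the smaller trace.  This is why a form that is
  nonzero on its radical becomes zero there after a quadratic extension.
\<close>

lemma trace2_double:
  assumes "(x :: 'a) \<in> GF2 n"
  shows "trace2 (n * 2) x = 0"
proof -
  have "(\<Sum>j<2. x ^ (2 ^ (n * j))) = 0"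
    using assms by (simp add: numeral_2_eq_2 GF2_def)
  hence "trace2 n (\<Sum>j<2. x ^ (2 ^ (n * j))) = 0"
    by simp
  thus ?thesis by (simp only: trace2_trans)
qed

text \<open>
  A finite field that contains the coefficient field contains the splitting field as soon as it
  contains the roots, since it is closed under the field operations.
\<close>

lemma splitting_field_subset_iff:
  assumes "m dvd n"
  shows "splitting_field (GF2 m) p \<subseteq> GF2 n \<longleftrightarrow> {x. poly p x = 0} \<subseteq> (GF2 n :: 'a set)"
proof
  assume "splitting_field (GF2 m) p \<subseteq> GF2 n"
  moreover have "{x. poly p x = 0} \<subseteq> splitting_field (GF2 m) p"
    by (auto simp: splitting_field_def intro: generate_field.incl)
  ultimately show "{x. poly p x = 0} \<subseteq> GF2 n" by blast
next
  assume sub: "{x. poly p x = 0} \<subseteq> GF2 n"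
  let ?R = "ring_of_type_algebra :: 'a ring"
  interpret R: Ring.field ?R by (rule field_from_type_algebra)
  have R: "\<one>\<^bsub>?R\<^esub> = 1" "\<zero>\<^bsub>?R\<^esub> = 0" "carrier ?R = UNIV" "\<And>x y. x \<oplus>\<^bsub>?R\<^esub> y = x + y"
     "\<And>x y. x \<otimes>\<^bsub>?R\<^esub> y = x * y"
    by (simp_all add: ring_of_type_algebra_def)
  have neg: "\<ominus>\<^bsub>?R\<^esub> x = x" for x
    by (rule R.sum_zero_eq_neg[symmetric]) (simp_all add: R)
  have inv: "inv\<^bsub>?R\<^esub> x = inverse x" if "x \<noteq> 0" for x
    by (rule R.inv_unique'[symmetric]) (simp_all add: R that)
  have "x \<in> GF2 n" if "x \<in> splitting_field (GF2 m) p" for x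
    using that unfolding splitting_field_def
  proof (induction rule: generate_field.induct)
    case (incl h)
    thus ?case using sub GF2_mono[OF assms] by auto
  qed (auto simp: R neg inv GF2_add GF2_mult GF2_inverse)
  thus "splitting_field (GF2 m) p \<subseteq> GF2 n" by blast
qed

end

section \<open>Power sums of complex numbers and orders of roots of unity\<close>

lemma power_eq_1_iff_unity_order_dvd:
  assumes "n > 0" "z ^ n = 1"
  shows "z ^ k = 1 \<longleftrightarrow> unity_order z dvd k" and "unity_order z > 0"
proof -
  let ?o = "unity_order z"
  have o: "?o > 0 \<and> z ^ ?o = 1"
    unfolding unity_order_def by (rule LeastI[of _ n]) (use assms in simp)
  thus "?o > 0" by simp
  have red: "z ^ k = z ^ (k mod ?o)"
  proof -
    have "z ^ (?o * (k div ?o) + k mod ?o) = (z ^ ?o) ^ (k div ?o) * z ^ (k mod ?o)"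
      by (simp only: power_add power_mult)
    thus ?thesis using o by simp
  qed
  show "z ^ k = 1 \<longleftrightarrow> ?o dvd k"
  proof
    assume "z ^ k = 1"
    hence z: "z ^ (k mod ?o) = 1" using red by simp
    have lt: "k mod ?o < ?o" using o by simp
    have "k mod ?o = 0"
    proof (rule ccontr)
      assume "k mod ?o \<noteq> 0"
      hence "?o \<le> k mod ?o"
        using z Least_le[of "\<lambda>n. n > 0 \<and> z ^ n = 1" "k mod ?o"] by (simp add: unity_order_def)
      thus False using lt by simp
    qed
    thus "?o dvd k" by auto
  next
    assume "?o dvd k"
    thus "z ^ k = 1" using red by simp
  qed
qed

text \<open>
  The order of \<open>z\<close> divides \<open>2 * n\<close> with an odd quotient, because it does not divide \<open>n\<close>.
\<close>

lemma multiplicity_unity_order: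
  assumes "n > 0" "z ^ n = -1"
  shows "multiplicity 2 (unity_order z) = multiplicity 2 n + 1"
proof -
  have one: "z ^ (2 * n) = 1"
    using assms(2) by (simp add: power_mult mult.commute[of 2])
  have dvd: "unity_order z dvd 2 * n" and pos: "unity_order z > 0"
    using power_eq_1_iff_unity_order_dvd(1)[OF _ one, of "2 * n"] one
      power_eq_1_iff_unity_order_dvd(2)[OF _ one] assms(1) by auto
  have ndvd: "\<not> unity_order z dvd n"
    using power_eq_1_iff_unity_order_dvd(1)[OF _ one, of n] assms by auto
  obtain k where k: "2 * n = unity_order z * k"
    using dvd by (elim dvdE)
  have "odd k"
  proof
    assume "even k"
    then obtain j where "k = 2 * j" by (elim evenE)
    hence "n = unity_order z * j" using k by simp
    thus False using ndvd by simp
  qed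
  have "k \<noteq> 0" using k assms(1) by (intro notI) simp
  have "multiplicity 2 (2 * n) = multiplicity 2 (unity_order z) + multiplicity 2 k"
    unfolding k using pos \<open>k \<noteq> 0\<close> by (intro prime_elem_multiplicity_mult_distrib) auto
  moreover have "multiplicity 2 k = 0"
    using \<open>odd k\<close> by (simp add: not_dvd_imp_multiplicity_0)
  moreover have "multiplicity 2 (2 * n) = Suc (multiplicity 2 n)"
    using assms(1) by (intro multiplicity_times_same) auto
  ultimately show ?thesis by simp
qed

lemma Lcm_unity_order_dvd_iff:
  assumes "n > 0" "\<And>z. z \<in> A \<Longrightarrow> z ^ n = 1"
  shows "Lcm (unity_order ` A) dvd k \<longleftrightarrow> (\<forall>z\<in>A. z ^ k = 1)"
  using power_eq_1_iff_unity_order_dvd(1)[OF assms] by (auto simp: Lcm_dvd_iff)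

text \<open>
  Let \<open>Q\<close> vanish at all members of \<open>B\<close> except \<open>b\<close>.  The combination of consecutive power sums with
  the coefficients of \<open>Q\<close> isolates a nonzero multiple of \<open>b ^ n\<close>, so the powers of \<open>b\<close> are bounded.
  Multiplicities cannot cancel because they are positive integers.
\<close>

lemma bounded_power_sums_imp_norm_le_1:
  fixes B :: "complex multiset"
  assumes bound: "\<And>n. n \<ge> 1 \<Longrightarrow> norm (\<Sum>b\<in>#B. b ^ n) \<le> C" and b: "b \<in># B"
  shows "norm b \<le> 1"
proof (rule ccontr)
  assume gt: "\<not> norm b \<le> 1"
  define Q where "Q = (\<Prod>c\<in>set_mset B - {b}. [:-c, 1:])"
  have Qc: "poly Q c = 0" if "c \<in># B" "c \<noteq> b" for c
    using that by (auto simp: Q_def poly_prod)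
  have Qb: "poly Q b \<noteq> 0"
    by (auto simp: Q_def poly_prod)
  define M where "M = (\<Sum>k\<le>degree Q. norm (coeff Q k) * C)"
  define \<mu> where "\<mu> = norm (of_nat (count B b) * poly Q b)"
  have \<mu>: "\<mu> > 0"
    using Qb b by (simp add: \<mu>_def)
  have bnd: "norm b ^ n * \<mu> \<le> M" if n: "n \<ge> 1" for n
  proof -
    have "(\<Sum>k\<le>degree Q. coeff Q k * (\<Sum>c\<in>#B. c ^ (n + k))) = (\<Sum>c\<in>#B. c ^ n * poly Q c)"
    proof -
      have "(\<Sum>k\<le>degree Q. coeff Q k * (\<Sum>c\<in>#A. c ^ (n + k))) = (\<Sum>c\<in>#A. c ^ n * poly Q c)" for A
      proof (induction A)
        case (add c A)
        thus ?case
          by (simp add: distrib_left sum.distrib poly_altdef sum_distrib_left power_add algebra_simps)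
      qed simp
      thus ?thesis .
    qed
    also have "\<dots> = of_nat (count B b) * (b ^ n * poly Q b)"
    proof -
      have "(\<Sum>c\<in>#A. c ^ n * poly Q c) = of_nat (count A b) * (b ^ n * poly Q b)" if "A \<subseteq># B" for A
        using that
      proof (induction A)
        case (add c A)
        hence "c \<in># B" "A \<subseteq># B"
          by (auto dest: mset_subset_eq_insertD simp: subset_mset.less_imp_le)
        thus ?case
          using add.IH Qc[of c] by (cases "c = b") (auto simp: algebra_simps)
      qed simp
      thus ?thesis by blast
    qed
    finally have eq: "b ^ n * (of_nat (count B b) * poly Q b) =
        (\<Sum>k\<le>degree Q. coeff Q k * (\<Sum>c\<in>#B. c ^ (n + k)))"
      by (simp add: mult_ac)
    have "norm b ^ n * \<mu> = norm (b ^ n * (of_nat (count B b) * poly Q b))"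
      by (simp add: \<mu>_def norm_mult norm_power)
    also have "\<dots> \<le> (\<Sum>k\<le>degree Q. norm (coeff Q k * (\<Sum>c\<in>#B. c ^ (n + k))))"
      unfolding eq by (rule norm_sum)
    also have "\<dots> \<le> M"
      unfolding M_def using bound n by (intro sum_mono) (auto simp: norm_mult intro!: mult_left_mono)
    finally show ?thesis .
  qed
  obtain n where n: "M / \<mu> < norm b ^ n"
    using real_arch_pow[of "norm b" "M / \<mu>"] gt by auto
  have "norm b ^ n \<le> norm b ^ Suc n"
    using gt by (intro power_increasing) auto
  hence "M / \<mu> < norm b ^ Suc n" using n by linarith
  hence "M < norm b ^ Suc n * \<mu>" using \<mu> by (simp add: pos_divide_less_eq)
  thus False using bnd[of "Suc n"] by simp
qed

lemma eq_1_if_norm_le_1_Re_ge_1: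
  assumes "norm z \<le> 1" "Re z \<ge> 1"
  shows "z = 1"
proof -
  have "Re z \<le> norm z" by (rule complex_Re_le_cmod)
  hence r: "Re z = 1" using assms by linarith
  have "(norm z)\<^sup>2 \<le> 1" using assms(1) by (simp add: power_le_one)
  hence "(Im z)\<^sup>2 \<le> 0" by (simp add: cmod_power2 r)
  thus ?thesis using r by (simp add: complex_eq_iff)
qed

text \<open>
  Equality in the triangle inequality: a sum of at most \<open>M\<close> numbers from the unit disc can be
  \<open>\<plusminus>M\<close> only if every summand is \<open>\<plusminus>1\<close>.
\<close>

lemma extremal_sum_imp_all_eq:
  fixes B :: "complex multiset" and g :: "complex \<Rightarrow> complex"
  assumes "\<And>z. z \<in># B \<Longrightarrow> norm (g z) \<le> 1" "size B \<le> M" "(\<Sum>z\<in>#B. g z) = of_nat M * \<sigma>"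
    and \<sigma>: "\<sigma> = 1 \<or> \<sigma> = -1"
  shows "\<forall>z\<in>#B. g z = \<sigma>"
proof -
  define h where "h z = 1 - Re (\<sigma> * g z)" for z
  have nn: "h z \<ge> 0" if "z \<in># B" for z
    using complex_Re_le_cmod[of "\<sigma> * g z"] assms(1)[OF that] \<sigma>
    by (auto simp: h_def norm_mult)
  have sum_h: "(\<Sum>z\<in>#A. h z) = of_nat (size A) - Re (\<sigma> * (\<Sum>z\<in>#A. g z))" for A
    by (induction A) (auto simp: h_def distrib_left)
  have "(\<Sum>z\<in>#B. h z) = of_nat (size B) - of_nat M"
    using assms(3) \<sigma> sum_h[of B] by auto
  hence le: "(\<Sum>z\<in>#B. h z) \<le> 0"
    using assms(2) by simp
  show ?thesis
  proof
    fix z assume z: "z \<in># B"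
    have "h z \<le> (\<Sum>z\<in>#B. h z)"
    proof -
      obtain A where A: "B = add_mset z A" using multi_member_split[OF z] by blast
      have "(\<Sum>z\<in>#A'. h z) \<ge> 0" if "A' \<subseteq># A" for A'
        using that
      proof (induction A')
        case (add c A')
        hence "c \<in># A" "A' \<subseteq># A"
          by (auto dest: mset_subset_eq_insertD simp: subset_mset.less_imp_le)
        thus ?case using add.IH nn[of c] A by simp
      qed simp
      hence "(\<Sum>z\<in>#A. h z) \<ge> 0" by blast
      thus ?thesis by (simp add: A)
    qed
    hence "Re (\<sigma> * g z) \<ge> 1" using le by (simp add: h_def)
    moreover have "norm (\<sigma> * g z) \<le> 1"
      using assms(1)[OF z] \<sigma> by (auto simp: norm_mult)
    ultimately have "\<sigma> * g z = 1" by (intro eq_1_if_norm_le_1_Re_ge_1)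
    moreover have "\<sigma> * \<sigma> = 1" using \<sigma> by auto
    ultimately have "\<sigma> * g z = \<sigma> * \<sigma>" by simp
    moreover have "\<sigma> \<noteq> 0" using \<sigma> by auto
    ultimately show "g z = \<sigma>" by simp
  qed
qed

lemma reciprocal_factorization:
  fixes P :: "complex poly"
  assumes "coeff P 0 = 1"
  obtains B where "P = (\<Prod>b\<in>#B. [:1, -b:])" "size B = degree P" "0 \<notin># B"
proof -
  define A where "A = proots P"
  have "P \<noteq> 0" using assms by auto
  have nz: "x \<noteq> 0" if "x \<in># A" for x
    using that assms \<open>P \<noteq> 0\<close> by (auto simp: A_def poly_0_coeff_0)
  have lin: "\<exists>c. (\<Prod>x\<in>#A'. [:-x, 1:]) = smult c (\<Prod>b\<in>#image_mset inverse A'. [:1, -b:])"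
    if "\<And>x. x \<in># A' \<Longrightarrow> x \<noteq> 0" for A' :: "complex multiset"
    using that
  proof (induction A')
    case empty
    show ?case by (intro exI[of _ 1]) simp
  next
    case (add x A')
    then obtain c where c: "(\<Prod>x\<in>#A'. [:-x, 1:]) = smult c (\<Prod>b\<in>#image_mset inverse A'. [:1, -b:])"
      by auto
    have "[:-x, 1:] = smult (-x) [:1, -inverse x:]"
      using add.prems[of x] by simp
    hence "(\<Prod>x\<in>#add_mset x A'. [:-x, 1:]) =
        smult (-x) [:1, -inverse x:] * smult c (\<Prod>b\<in>#image_mset inverse A'. [:1, -b:])"
      using c by (simp only: image_mset_add_mset prod_mset.add_mset)
    also have "\<dots> = smult (-x * c) (\<Prod>b\<in>#image_mset inverse (add_mset x A'). [:1, -b:])"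
      by (simp only: image_mset_add_mset prod_mset.add_mset mult_smult_left mult_smult_right
          smult_smult mult.commute[of c])
    finally show ?case by blast
  qed
  obtain c where c: "(\<Prod>x\<in>#A. [:-x, 1:]) = smult c (\<Prod>b\<in>#image_mset inverse A. [:1, -b:])"
    using lin nz by blast
  define e where "e = lead_coeff P * c"
  have P: "P = smult e (\<Prod>b\<in>#image_mset inverse A. [:1, -b:])"
    using complex_poly_decompose_multiset[of P] by (simp add: A_def[symmetric] c e_def)
  have "coeff (\<Prod>b\<in>#B. [:1, -b:]) 0 = 1" for B :: "complex multiset"
    by (induction B) (auto simp: coeff_mult_0)
  hence "e = 1" using assms by (subst (asm) P) simp
  thus ?thesis
    using P nz size_proots_complex[of P] by (intro that[of "image_mset inverse A"]) (auto simp: A_def)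
qed

lemma reciprocal_roots_prod:
  assumes "0 \<notin># B"
  shows "reciprocal_roots (fps_of_poly (\<Prod>b\<in>#B. [:1, -b:])) = set_mset B"
proof -
  have roots: "poly (\<Prod>b\<in>#B. [:1, -b:]) (inverse \<beta>) = 0 \<longleftrightarrow> \<beta> \<in># B" if "\<beta> \<noteq> 0" for \<beta>
    using that by (auto simp: poly_prod_mset prod_mset_zero_iff field_simps)
  have "\<beta> \<in> reciprocal_roots (fps_of_poly (\<Prod>b\<in>#B. [:1, -b:])) \<longleftrightarrow> \<beta> \<in># B" for \<beta>
    using roots[of \<beta>] assms by (cases "\<beta> = 0") (simp_all add: reciprocal_roots_def fps_of_poly_eq_iff)
  thus ?thesis by blast
qed

text \<open>
  The logarithmic derivative of \<open>\<Prod>(1 - bX)\<close> is the generating function of the power sums.  Over the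
  complex numbers it recovers the reciprocal roots of an L-function from the exponential sums; in
  characteristic two it yields Newton's identities.
\<close>

lemma log_deriv_linear_factors:
  fixes B :: "'a::field multiset"
  defines "F \<equiv> fps_of_poly (\<Prod>b\<in>#B. [:1, -b:])"
  shows "fps_X * fps_deriv F = - Abs_fps (\<lambda>n. if n = 0 then 0 else \<Sum>b\<in>#B. b ^ n) * F"
proof -
  define G where "G b = Abs_fps (\<lambda>n. if n = 0 then 0 else b ^ n)" for b :: 'a
  have lin: "fps_of_poly [:1, -b:] = 1 - fps_const b * fps_X" for b :: 'a
    by (simp add: fps_of_poly_pCons mult.commute flip: fps_const_neg)
  have G: "G b * fps_of_poly [:1, -b:] = fps_const b * fps_X" for b
  proof (rule fps_ext)
    fix k
    have "G b * fps_of_poly [:1, -b:] = G b - fps_const b * (fps_X * G b)"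
      by (simp add: lin algebra_simps)
    thus "fps_nth (G b * fps_of_poly [:1, -b:]) k = fps_nth (fps_const b * fps_X) k"
      by (cases k; cases "k - 1") (simp_all add: G_def fps_X_nth)
  qed
  have "fps_X * fps_deriv (fps_of_poly (\<Prod>b\<in>#A. [:1, -b:])) =
      - (\<Sum>b\<in>#A. G b) * fps_of_poly (\<Prod>b\<in>#A. [:1, -b:])" for A
  proof (induction A)
    case (add b A)
    define H where "H = fps_of_poly (\<Prod>b\<in>#A. [:1, -b:])"
    define l where "l = fps_of_poly [:1, -b:]"
    have l: "fps_deriv l = - fps_const b"
      by (simp add: l_def lin del: fps_const_neg)
    have H: "fps_of_poly (\<Prod>b\<in>#add_mset b A. [:1, -b:]) = l * H"
      by (simp only: image_mset_add_mset prod_mset.add_mset fps_of_poly_mult l_def H_def)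
    have "fps_X * fps_deriv (l * H) = - (fps_const b * fps_X) * H + l * (fps_X * fps_deriv H)"
      by (simp add: l algebra_simps del: fps_const_neg)
    also have "\<dots> = - (G b * l) * H + l * (- (\<Sum>b\<in>#A. G b) * H)"
      using add by (simp only: G[symmetric] l_def H_def)
    also have "\<dots> = - (\<Sum>b\<in>#add_mset b A. G b) * (l * H)"
      by (simp add: algebra_simps)
    finally show ?case by (simp only: H)
  qed simp
  moreover have "(\<Sum>b\<in>#A. G b) = Abs_fps (\<lambda>n. if n = 0 then 0 else \<Sum>b\<in>#A. b ^ n)" for A
    by (induction A) (auto simp: G_def fps_eq_iff)
  ultimately show ?thesis by (simp add: F_def)
qed

lemma coeff_0_linear_factors: "coeff (\<Prod>b\<in>#B. [:1, -b:] :: 'a::field poly) 0 = 1"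
  by (induction B) (auto simp: coeff_mult_0)

lemma power_sums_from_log_deriv:
  fixes B :: "complex multiset"
  defines "F \<equiv> fps_of_poly (\<Prod>b\<in>#B. [:1, -b:])"
  assumes log_deriv: "fps_X * fps_deriv F = Abs_fps (\<lambda>n. if n = 0 then 0 else s n) * F"
    and n: "n \<ge> 1"
  shows "s n = - (\<Sum>b\<in>#B. b ^ n)"
proof -
  let ?G = "Abs_fps (\<lambda>n. if n = 0 then 0 else \<Sum>b\<in>#B. b ^ n)"
  have "Abs_fps (\<lambda>n. if n = 0 then 0 else s n) * F = - ?G * F"
    using log_deriv log_deriv_linear_factors[of B] by (simp add: F_def)
  moreover have "fps_nth F 0 \<noteq> 0"
    by (simp add: F_def coeff_0_linear_factors)
  hence "F \<noteq> 0" by auto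
  ultimately have "Abs_fps (\<lambda>n. if n = 0 then 0 else s n) = - ?G"
    by (simp only: mult_cancel_right simp_thms)
  hence "fps_nth (Abs_fps (\<lambda>n. if n = 0 then 0 else s n)) n = fps_nth (- ?G) n"
    by simp
  thus ?thesis using n by simp
qed

text \<open>
  A power series over \<open>\<complex>\<close> is determined by its constant term and its logarithmic derivative, as the
  coefficients satisfy a recurrence.
\<close>

lemma log_deriv_unique:
  fixes F G H :: "complex fps"
  assumes "fps_nth F 0 = fps_nth G 0" "fps_X * fps_deriv F = H * F" "fps_X * fps_deriv G = H * G"
    and "fps_nth H 0 = 0"
  shows "F = G"
proof (rule fps_ext)
  have rec: "of_nat n * fps_nth E n = (\<Sum>i=1..n. fps_nth H i * fps_nth E (n - i))"
    if "fps_X * fps_deriv E = H * E" for E n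
  proof -
    have "of_nat n * fps_nth E n = fps_nth (fps_X * fps_deriv E) n"
      by (cases n) simp_all
    also have "\<dots> = (\<Sum>i=0..n. fps_nth H i * fps_nth E (n - i))"
      by (simp add: that fps_mult_nth)
    also have "\<dots> = (\<Sum>i=1..n. fps_nth H i * fps_nth E (n - i))"
      using assms(4) by (simp add: sum.atLeast_Suc_atMost)
    finally show ?thesis .
  qed
  fix n show "fps_nth F n = fps_nth G n"
  proof (induction n rule: less_induct)
    case (less n)
    show ?case
    proof (cases "n = 0")
      case False
      have "of_nat n * fps_nth F n = of_nat n * fps_nth G n"
        unfolding rec[OF assms(2)] rec[OF assms(3)] using less False by (intro sum.cong) auto
      thus ?thesis using False by simp
    qed (use assms(1) in simp)
  qed
qed

section \<open>The L-function of a polynomial of odd degree\<close>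

text \<open>
  Newton's identity, solved for the \<open>k\<close>-th power sum.  No division by \<open>k\<close> occurs, so it is usable
  in positive characteristic.
\<close>

lemma newton_coefficients:
  fixes A :: "'a::field multiset"
  defines "c \<equiv> coeff (reflect_poly (\<Prod>x\<in>#A. [:-x, 1:]))"
  assumes "k \<ge> 1"
  shows "(\<Sum>x\<in>#A. x ^ k) = - (of_nat k * c k + (\<Sum>j=1..<k. (\<Sum>x\<in>#A. x ^ j) * c (k - j)))"
proof -
  define p where "p j = (\<Sum>x\<in>#A. x ^ j)" for j
  have refl1: "reflect_poly [:-x, 1:] = [:1, -x:]" for x :: 'a
    by (cases "x = 0") (auto simp: reflect_poly_pCons reflect_poly_pCons')
  have refl: "reflect_poly (\<Prod>x\<in>#A. [:-x, 1:]) = (\<Prod>x\<in>#A. [:1, -x:])"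
  proof (induction A)
    case (add x A)
    show ?case
      by (simp only: image_mset_add_mset prod_mset.add_mset reflect_poly_mult refl1 add)
  qed simp
  have c0: "c 0 = 1"
    using coeff_0_linear_factors[of A] by (simp add: c_def refl)
  define F where "F = fps_of_poly (\<Prod>x\<in>#A. [:1, -x:])"
  have F: "fps_nth F j = c j" for j
    by (simp add: F_def c_def refl)
  have "of_nat k * c k = fps_nth (fps_X * fps_deriv F) k"
    using assms(2) by (cases k) (simp_all add: F)
  also have "\<dots> = - (\<Sum>j=0..k. (if j = 0 then 0 else p j) * c (k - j))"
    by (simp only: F_def log_deriv_linear_factors p_def) (simp add: fps_mult_nth c_def refl sum_negf)
  also have "(\<Sum>j=0..k. (if j = 0 then 0 else p j) * c (k - j)) = (\<Sum>j=1..k. p j * c (k - j))"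
    by (simp add: sum.atLeast_Suc_atMost)
  also have "\<dots> = (\<Sum>j=1..<k. p j * c (k - j)) + p k"
    using assms(2) c0 by (cases k) (simp_all add: sum.atLeastLessThan_Suc atLeastLessThanSuc_atLeastAtMost)
  finally show ?thesis
    by (simp add: p_def algebra_simps)
qed

locale finite_subfield = alg_closed_char_two ty for ty :: "'a::alg_closed_field itself" +
  fixes m :: nat
  assumes m_pos: "m \<ge> 1"
begin

text \<open>
  The \<open>k\<close>-th power of the Frobenius map over \<open>GF2 m\<close>.
\<close>

definition conjugate :: "nat \<Rightarrow> 'a \<Rightarrow> 'a" where
  "conjugate k x = x ^ (2 ^ (m * k))"

lemma conjugate_0 [simp]: "conjugate 0 x = x"
  by (simp add: conjugate_def)

lemma conjugate_conjugate: "conjugate j (conjugate k x) = conjugate (j + k) x"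
  by (simp add: conjugate_def add_mult_distrib2 power_add mult.commute flip: power_mult)

lemma conjugate_inj [simp]: "conjugate k x = conjugate k y \<longleftrightarrow> x = y"
  by (simp add: conjugate_def power_inj_frob)

lemma conjugate_fix_iff: "conjugate k x = x \<longleftrightarrow> x \<in> GF2 (m * k)"
  by (simp add: conjugate_def GF2_def)

lemma conjugate_ring:
  "conjugate k (x + y) = conjugate k x + conjugate k y" "conjugate k (x * y) = conjugate k x * conjugate k y"
  "conjugate k (sum g A) = (\<Sum>i\<in>A. conjugate k (g i))" "conjugate k 0 = 0" "conjugate k 1 = 1"
  "conjugate k (x ^ n) = conjugate k x ^ n"
  by (simp_all add: conjugate_def power_add_frob power_mult_distrib power_sum_frob power_0_left
      mult.commute flip: power_mult)

text \<open>
  The Frobenius map on coefficients; its fixed points are the polynomials over \<open>GF2 m\<close>.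
\<close>

definition frob :: "'a poly \<Rightarrow> 'a poly" where
  "frob p = map_poly (conjugate 1) p"

lemma coeff_frob [simp]: "coeff (frob p) i = conjugate 1 (coeff p i)"
  by (simp add: frob_def coeff_map_poly conjugate_ring)

lemma frob_mult: "frob (p * q) = frob p * frob q"
  by (rule poly_eqI) (simp add: coeff_mult conjugate_ring)

lemma frob_linear: "frob [:-x, 1:] = [:- conjugate 1 x, 1:]"
  by (rule poly_eqI) (simp add: uminus_eq coeff_pCons conjugate_ring split: nat.splits)

lemma frob_fix_iff: "frob p = p \<longleftrightarrow> (\<forall>i. coeff p i \<in> GF2 m)"
  by (simp add: poly_eq_iff conjugate_fix_iff)

lemma poly_conjugate:
  assumes "frob p = p"
  shows "poly p (conjugate k x) = conjugate k (poly p x)"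
proof -
  have "conjugate k (coeff p i) = coeff p i" for i
    using assms GF2_mono[of m "m * k"] by (auto simp: frob_fix_iff conjugate_fix_iff)
  thus ?thesis
    by (simp add: poly_altdef conjugate_ring)
qed

text \<open>
  If \<open>x\<close> lies in the extension of degree \<open>k\<close> of \<open>GF2 m\<close>, this is the norm of \<open>T - x\<close>, that is, the
  power of the minimal polynomial of \<open>x\<close> that has degree \<open>k\<close>.
\<close>

definition orbit_poly :: "nat \<Rightarrow> 'a \<Rightarrow> 'a poly" where
  "orbit_poly k x = (\<Prod>j<k. [:- conjugate j x, 1:])"

lemma orbit_poly_Suc: "orbit_poly (Suc k) x = orbit_poly k x * [:- conjugate k x, 1:]"
  by (simp add: orbit_poly_def)

lemma orbit_poly_Suc': "orbit_poly (Suc k) x = [:- x, 1:] * orbit_poly k (conjugate 1 x)"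
  unfolding orbit_poly_def prod.lessThan_Suc_shift by (simp add: conjugate_conjugate)

lemma orbit_poly_nonzero [simp]: "orbit_poly k x \<noteq> 0"
  by (simp add: orbit_poly_def)

lemma degree_orbit_poly: "degree (orbit_poly k x) = k"
  by (simp add: orbit_poly_def degree_prod_sum_eq)

lemma monic_orbit_poly: "lead_coeff (orbit_poly k x) = 1"
  by (simp add: orbit_poly_def lead_coeff_prod)

lemma poly_orbit_poly_eq_0_iff: "poly (orbit_poly k x) y = 0 \<longleftrightarrow> (\<exists>j<k. y = conjugate j x)"
  by (auto simp: orbit_poly_def poly_prod)

lemma frob_orbit_poly:
  assumes "conjugate k x = x"
  shows "frob (orbit_poly k x) = orbit_poly k x"
proof -
  have "frob (orbit_poly j x) = orbit_poly j (conjugate 1 x)" for j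
  proof (induction j)
    case 0
    show ?case by (rule poly_eqI) (simp add: orbit_poly_def conjugate_ring)
  next
    case (Suc j)
    thus ?case
      by (simp only: orbit_poly_Suc frob_mult frob_linear conjugate_conjugate add.commute[of 1])
  qed
  moreover have "[:-x, 1:] * orbit_poly k (conjugate 1 x) = [:-x, 1:] * orbit_poly k x"
    by (simp only: orbit_poly_Suc'[symmetric]) (simp only: orbit_poly_Suc assms mult.commute)
  hence "orbit_poly k (conjugate 1 x) = orbit_poly k x"
    unfolding mult_cancel_left by simp
  ultimately show ?thesis by simp
qed

lemma orbit_poly_add:
  assumes "conjugate e x = x"
  shows "orbit_poly (e + k) x = orbit_poly e x * orbit_poly k x"
proof (induction k)
  case (Suc k)
  have "conjugate (e + k) x = conjugate k x"
    using assms by (simp add: add.commute[of e] flip: conjugate_conjugate)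
  thus ?case using Suc by (simp only: add_Suc_right orbit_poly_Suc mult.assoc)
qed (simp add: orbit_poly_def)

lemma conjugate_eqD:
  assumes "conjugate i x = conjugate j x" "i \<le> j"
  shows "conjugate (j - i) x = x"
proof -
  have "conjugate i (conjugate (j - i) x) = conjugate i x"
    using assms by (simp add: conjugate_conjugate)
  thus ?thesis by simp
qed

definition orbit_divisors :: "'a poly \<Rightarrow> 'a \<Rightarrow> nat set" where
  "orbit_divisors g x = {k. k \<ge> 1 \<and> conjugate k x = x \<and> orbit_poly k x dvd g}"

text \<open>
  Let \<open>e\<close> be the degree of \<open>x\<close> over \<open>GF2 m\<close>.  The norms of degree \<open>e, 2e, ...\<close> are the powers of the
  minimal polynomial, and as many of them divide \<open>g\<close> as the multiplicity of the root \<open>x\<close>.  The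
  induction removes one copy of the minimal polynomial at a time.
\<close>

lemma card_orbit_divisors:
  assumes "g \<noteq> 0" "frob g = g"
  shows "finite (orbit_divisors g x) \<and> card (orbit_divisors g x) = order x g"
  using assms
proof (induction "degree g" arbitrary: g rule: less_induct)
  case (less g)
  show ?case
  proof (cases "poly g x = 0")
    case False
    have "k \<notin> orbit_divisors g x" for k
    proof
      assume "k \<in> orbit_divisors g x"
      hence "k \<ge> 1" "orbit_poly k x dvd g" by (auto simp: orbit_divisors_def)
      moreover from this have "poly (orbit_poly k x) x = 0"
        unfolding poly_orbit_poly_eq_0_iff by (intro exI[of _ 0]) simp
      ultimately have "poly g x = 0" by (auto elim!: dvdE)
      thus False using False by simp
    qed
    hence "orbit_divisors g x = {}" by blast
    thus ?thesis using False by (simp add: order_0I)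
  next
    case True
    have root: "poly g (conjugate k x) = 0" for k
      using poly_conjugate[OF less.prems(2)] True by (simp add: conjugate_ring)
    have "\<exists>e>0. conjugate e x = x"
    proof -
      have "finite (range (\<lambda>k. conjugate k x))"
        by (rule finite_subset[OF _ poly_roots_finite[OF less.prems(1)]]) (use root in auto)
      hence "\<not> inj (\<lambda>k. conjugate k x)"
        using finite_imageD infinite_UNIV_nat by blast
      then obtain i j where ij: "conjugate i x = conjugate j x" "i \<noteq> j"
        unfolding inj_def by blast
      show ?thesis
      proof (cases "i < j")
        case True
        thus ?thesis using conjugate_eqD[of i x j] ij by (intro exI[of _ "j - i"]) simp
      next
        case False
        thus ?thesis using conjugate_eqD[of j x i] ij by (intro exI[of _ "i - j"]) simp
      qed
    qed
    define e where "e = (LEAST e. e > 0 \<and> conjugate e x = x)"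
    have e: "e > 0" "conjugate e x = x"
      using LeastI_ex[OF \<open>\<exists>e>0. conjugate e x = x\<close>] by (auto simp: e_def)
    have e_min: "e \<le> k" if "k > 0" "conjugate k x = x" for k
      using that unfolding e_def by (intro Least_le) simp
    have distinct: "conjugate i x \<noteq> conjugate j x" if "i < j" "j < e" for i j
      using conjugate_eqD[of i x j] e_min[of "j - i"] that by force
    have "orbit_poly k x dvd g" if "k \<le> e" for k
      using that
    proof (induction k)
      case 0
      thus ?case by (simp add: orbit_poly_def)
    next
      case (Suc k)
      then obtain h where h: "g = orbit_poly k x * h" by (auto elim: dvdE)
      have "poly (orbit_poly k x) (conjugate k x) \<noteq> 0"
      proof
        assume "poly (orbit_poly k x) (conjugate k x) = 0"
        then obtain j where "j < k" "conjugate k x = conjugate j x"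
          by (auto simp only: poly_orbit_poly_eq_0_iff)
        thus False using distinct[of j k] Suc.prems by simp
      qed
      hence "poly h (conjugate k x) = 0"
        using root[of k] by (simp add: h)
      hence "[:- conjugate k x, 1:] dvd h"
        by (simp only: poly_eq_0_iff_dvd)
      thus ?case
        unfolding h orbit_poly_Suc by (intro mult_dvd_mono) auto
    qed
    then obtain h where h: "g = orbit_poly e x * h" by blast
    have h0: "h \<noteq> 0" using less.prems(1) h by auto
    have "orbit_poly e x * frob h = orbit_poly e x * h"
      using less.prems(2) frob_orbit_poly[OF e(2)] by (simp add: h frob_mult)
    hence frob_h: "frob h = h" by simp
    have "degree g = e + degree h"
      using h0 by (simp add: h degree_mult_eq degree_orbit_poly)
    hence IH: "finite (orbit_divisors h x)" "card (orbit_divisors h x) = order x h"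
      using less.hyps[of h] h0 frob_h e(1) by auto
    have "order x (orbit_poly e x) = 1"
    proof -
      obtain e' where e': "e = Suc e'" using e(1) by (cases e) auto
      have "poly (orbit_poly e' (conjugate 1 x)) x \<noteq> 0"
      proof
        assume "poly (orbit_poly e' (conjugate 1 x)) x = 0"
        then obtain j where "j < e'" "conjugate 0 x = conjugate (Suc j) x"
          by (auto simp: poly_orbit_poly_eq_0_iff conjugate_conjugate)
        thus False using distinct[of 0 "Suc j"] e' by simp
      qed
      moreover have "order x [:-x, 1:] = 1"
        using order_power_n_n[of x 1] by simp
      ultimately show ?thesis
        unfolding e' orbit_poly_Suc' by (subst order_mult) (simp_all add: order_0I del: mult_pCons_left)
    qed
    hence ord: "order x g = Suc (order x h)"
      using less.prems(1) by (simp add: h order_mult)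
    have eq: "orbit_divisors g x = insert e ((+) e ` orbit_divisors h x)"
    proof (intro equalityI subsetI)
      fix k assume k: "k \<in> orbit_divisors g x"
      hence "e \<le> k" using e_min by (auto simp: orbit_divisors_def)
      then obtain k' where k': "k = e + k'" by (auto simp: le_iff_add)
      show "k \<in> insert e ((+) e ` orbit_divisors h x)"
      proof (cases "k' = 0")
        case False
        have "conjugate k' x = x"
          using k e(2) by (simp add: orbit_divisors_def k' add.commute[of e] flip: conjugate_conjugate)
        moreover have "orbit_poly k' x dvd h"
          using k by (simp add: orbit_divisors_def k' h orbit_poly_add[OF e(2)])
        ultimately show ?thesis using False k' by (auto simp: orbit_divisors_def)
      qed (simp add: k')
    next
      fix k assume "k \<in> insert e ((+) e ` orbit_divisors h x)"
      thus "k \<in> orbit_divisors g x"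
      proof
        assume "k = e"
        thus ?thesis using e by (simp add: orbit_divisors_def h Suc_le_eq)
      next
        assume "k \<in> (+) e ` orbit_divisors h x"
        then obtain k' where k': "k = e + k'" "k' \<in> orbit_divisors h x" by auto
        moreover have "conjugate (e + k') x = x"
          using k'(2) e(2) by (simp add: orbit_divisors_def flip: conjugate_conjugate)
        ultimately show ?thesis
          by (simp add: orbit_divisors_def h orbit_poly_add[OF e(2)])
      qed
    qed
    have "e \<notin> (+) e ` orbit_divisors h x"
      by (auto simp: orbit_divisors_def)
    thus ?thesis
      using IH by (simp add: eq ord card_image)
  qed
qed

definition monics :: "nat \<Rightarrow> 'a poly set" where
  "monics n = {g. degree g = n \<and> lead_coeff g = 1 \<and> frob g = g}"

lemma monics_nonzero: "g \<in> monics n \<Longrightarrow> g \<noteq> 0"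
  by (auto simp: monics_def)

lemma coeff_monic: "g \<in> monics n \<Longrightarrow> coeff g n = 1"
  unfolding monics_def by blast

lemma finite_monics: "finite (monics n)"
proof (rule finite_subset)
  show "monics n \<subseteq> Poly ` {xs. set xs \<subseteq> (GF2 m :: 'a set) \<and> length xs \<le> n + 1}"
  proof
    fix g assume g: "g \<in> monics n"
    have "set (coeffs g) \<subseteq> GF2 m"
      using g by (auto simp: monics_def frob_fix_iff coeffs_def)
    moreover have "length (coeffs g) \<le> n + 1"
      using g monics_nonzero[OF g] by (auto simp: length_coeffs_degree monics_def)
    ultimately show "g \<in> Poly ` {xs. set xs \<subseteq> GF2 m \<and> length xs \<le> n + 1}"
      by (intro image_eqI[of _ _ "coeffs g"]) auto
  qed
  show "finite (Poly ` {xs. set xs \<subseteq> (GF2 m :: 'a set) \<and> length xs \<le> n + 1})"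
    by (intro finite_imageI finite_lists_length_le finite_GF2 m_pos)
qed

lemma orbit_poly_in_monics: "x \<in> GF2 (m * k) \<Longrightarrow> orbit_poly k x \<in> monics k"
  by (simp add: monics_def degree_orbit_poly monic_orbit_poly[unfolded degree_orbit_poly]
      frob_orbit_poly conjugate_fix_iff)

lemma mult_in_monics: "g \<in> monics i \<Longrightarrow> h \<in> monics j \<Longrightarrow> g * h \<in> monics (i + j)"
  using monics_nonzero[of g i] monics_nonzero[of h j]
  by (auto simp: monics_def degree_mult_eq frob_mult coeff_degree_mult lead_coeff_mult[unfolded degree_mult_eq])

text \<open>
  A monic \<open>g\<close> of degree \<open>n\<close> is a norm times a cofactor in as many ways as it has orbit divisors, and
  by \<open>card_orbit_divisors\<close> their number is the number of roots with multiplicity, namely \<open>n\<close>.  This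
  replaces the Euler product in the proof of the recurrence for the L-series.
\<close>

lemma orbit_divisor_pairs:
  "bij_betw (\<lambda>(k, x, h). (orbit_poly k x * h, x, k))
     (SIGMA k:{1..n}. GF2 (m * k) \<times> monics (n - k))
     (SIGMA g:monics n. SIGMA x:{x. poly g x = 0}. orbit_divisors g x)"
proof (rule bij_betw_byWitness[where f' = "\<lambda>(g, x, k). (k, x, g div orbit_poly k x)"])
  let ?A = "SIGMA k:{1..n}. (GF2 (m * k) :: 'a set) \<times> monics (n - k)"
  let ?B = "SIGMA g:monics n. SIGMA x:{x. poly g x = 0}. orbit_divisors g x"
  show "\<forall>a\<in>?A. (\<lambda>(g, x, k). (k, x, g div orbit_poly k x)) ((\<lambda>(k, x, h). (orbit_poly k x * h, x, k)) a) = a"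
    by auto
  show "\<forall>a\<in>?B. (\<lambda>(k, x, h). (orbit_poly k x * h, x, k)) ((\<lambda>(g, x, k). (k, x, g div orbit_poly k x)) a) = a"
    by (auto simp: orbit_divisors_def)
  show "(\<lambda>(k, x, h). (orbit_poly k x * h, x, k)) ` ?A \<subseteq> ?B"
  proof (intro image_subsetI)
    fix a assume "a \<in> ?A"
    then obtain k x h where a: "a = (k, x, h)" "1 \<le> k" "k \<le> n" "x \<in> GF2 (m * k)" "h \<in> monics (n - k)"
      by auto
    have "orbit_poly k x * h \<in> monics n"
      using mult_in_monics[OF orbit_poly_in_monics[OF a(4)] a(5)] a(3) by simp
    moreover have "poly (orbit_poly k x) x = 0"
      unfolding poly_orbit_poly_eq_0_iff using a(2) by (intro exI[of _ 0]) simp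
    ultimately show "(\<lambda>(k, x, h). (orbit_poly k x * h, x, k)) a \<in> ?B"
      using a by (simp add: orbit_divisors_def conjugate_fix_iff)
  qed
  show "(\<lambda>(g, x, k). (k, x, g div orbit_poly k x)) ` ?B \<subseteq> ?A"
  proof (intro image_subsetI)
    fix a assume "a \<in> ?B"
    then obtain g x k where a: "a = (g, x, k)" "g \<in> monics n" "k \<in> orbit_divisors g x"
      by auto
    hence k: "1 \<le> k" "conjugate k x = x" "orbit_poly k x dvd g"
      by (auto simp: orbit_divisors_def)
    then obtain h where h: "g = orbit_poly k x * h" by (elim dvdE)
    have "h \<noteq> 0" using monics_nonzero[OF a(2)] h by auto
    hence "degree g = k + degree h"
      by (simp add: h degree_mult_eq degree_orbit_poly)
    hence deg: "degree h = n - k" "k \<le> n"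
      using a(2) by (auto simp: monics_def)
    have "orbit_poly k x * frob h = orbit_poly k x * h"
      using a(2) frob_orbit_poly[OF k(2)] by (simp add: h frob_mult monics_def)
    hence "frob h = h" by simp
    moreover have "lead_coeff h = 1"
      using a(2) lead_coeff_mult[of "orbit_poly k x" h] by (simp add: monics_def h monic_orbit_poly)
    ultimately have "h \<in> monics (n - k)"
      using deg by (simp add: monics_def)
    thus "(\<lambda>(g, x, k). (k, x, g div orbit_poly k x)) a \<in> ?A"
      using k deg by (simp add: a(1) h conjugate_fix_iff)
  qed
qed

text \<open>
  The additive character of \<open>GF2 m\<close> applied to \<open>\<Sum> f(x)\<close> over the roots of \<open>g\<close> is a multiplicative
  character of the monic polynomials, and \<open>L(f, T)\<close> is its L-series.
\<close>

definition root_sum :: "'a poly \<Rightarrow> 'a poly \<Rightarrow> 'a" where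
  "root_sum f g = (\<Sum>x\<in>#proots g. poly f x)"

definition root_char :: "'a poly \<Rightarrow> 'a poly \<Rightarrow> complex" where
  "root_char f g = bit_sign (trace2 m (root_sum f g))"

lemma root_sum_mult: "g \<noteq> 0 \<Longrightarrow> h \<noteq> 0 \<Longrightarrow> root_sum f (g * h) = root_sum f g + root_sum f h"
  by (simp add: root_sum_def proots_mult)

lemma root_sum_orbit_poly: "root_sum f (orbit_poly k x) = (\<Sum>j<k. poly f (conjugate j x))"
proof (induction k)
  case 0
  show ?case by (simp add: root_sum_def orbit_poly_def)
next
  case (Suc k)
  have "root_sum f [:- conjugate k x, 1:] = poly f (conjugate k x)"
    by (simp add: root_sum_def)
  thus ?case
    using Suc by (simp only: orbit_poly_Suc sum.lessThan_Suc) (subst root_sum_mult, auto)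
qed

lemma monic_prod_proots:
  assumes "g \<in> monics n"
  shows "g = (\<Prod>x\<in>#proots g. [:-x, 1:])"
proof -
  obtain A where A: "g = smult (lead_coeff g) (\<Prod>x\<in>#A. [:-x, 1:])"
    using alg_closed_imp_factorization[OF monics_nonzero[OF assms]] by blast
  moreover have "lead_coeff g = 1"
    using assms unfolding monics_def by blast
  ultimately have g: "g = (\<Prod>x\<in>#A. [:-x, 1:])"
    by simp
  have "proots g = A"
    by (subst g) (rule proots_linear_factors)
  thus ?thesis using g by simp
qed

lemma newton_monic:
  assumes "g \<in> monics n" "k \<ge> 1"
  shows "(\<Sum>x\<in>#proots g. x ^ k) = - (of_nat k * coeff (reflect_poly g) k +
           (\<Sum>j=1..<k. (\<Sum>x\<in>#proots g. x ^ j) * coeff (reflect_poly g) (k - j)))"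
  using newton_coefficients[OF assms(2), of "proots g"]
  by (simp only: monic_prod_proots[OF assms(1), symmetric])

lemma size_proots_monic: "g \<in> monics n \<Longrightarrow> size (proots g) = n"
proof -
  assume g: "g \<in> monics n"
  have "degree (\<Prod>x\<in>#A. [:-x, 1:]) = size A" for A :: "'a multiset"
  proof (induction A)
    case (add x A)
    have "(\<Prod>x\<in>#A. [:-x, 1:]) \<noteq> (0 :: 'a poly)" by (auto simp: prod_mset_zero_iff)
    thus ?case using add by (simp add: degree_mult_eq del: mult_pCons_left)
  qed simp
  from this[of "proots g"] show ?thesis
    using monic_prod_proots[OF g] g by (simp add: monics_def)
qed

text \<open>
  Power sums of the roots are polynomial expressions in the coefficients, by Newton's identity.
\<close>

lemma power_sum_in_GF2:
  assumes g: "g \<in> monics n"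
  shows "(\<Sum>x\<in>#proots g. x ^ k) \<in> GF2 m"
proof (induction k rule: less_induct)
  case (less k)
  have c: "coeff (reflect_poly g) i \<in> GF2 m" for i
    using g by (auto simp: coeff_reflect_poly monics_def frob_fix_iff)
  have nat: "of_nat j \<in> (GF2 m :: 'a set)" for j
    by (induction j) (auto intro: GF2_add)
  show ?case
  proof (cases "k = 0")
    case True
    thus ?thesis using nat[of n] size_proots_monic[OF g] by simp
  next
    case False
    show ?thesis
      unfolding newton_monic[OF g, of k, OF False[THEN Suc_leI[OF neq0_conv[THEN iffD1]], folded One_nat_def]] uminus_eq
      by (intro GF2_add GF2_mult GF2_sum c nat less) auto
  qed
qed

lemma root_sum_power_sums:
  "root_sum f g = (\<Sum>j\<le>degree f. coeff f j * (\<Sum>x\<in>#proots g. x ^ j))"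
proof -
  have "(\<Sum>x\<in>#A. poly f x) = (\<Sum>j\<le>degree f. coeff f j * (\<Sum>x\<in>#A. x ^ j))" for A
    by (induction A) (simp_all add: poly_altdef sum.distrib distrib_left)
  thus ?thesis by (simp add: root_sum_def)
qed

context
  fixes f :: "'a poly"
  assumes f_over: "\<And>i. coeff f i \<in> GF2 m"
begin

lemma root_sum_in_GF2: "g \<in> monics n \<Longrightarrow> root_sum f g \<in> GF2 m"
  unfolding root_sum_power_sums by (intro GF2_sum GF2_mult f_over power_sum_in_GF2)

lemma root_char_orbit_poly:
  assumes "x \<in> GF2 (m * k)"
  shows "root_char f (orbit_poly k x) = bit_sign (q_form m f k x)"
proof -
  have "frob f = f" using f_over by (simp add: frob_fix_iff)
  hence "root_sum f (orbit_poly k x) = (\<Sum>j<k. poly f x ^ (2 ^ (m * j)))"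
    using poly_conjugate[of f] by (simp add: root_sum_orbit_poly conjugate_def)
  thus ?thesis by (simp add: root_char_def q_form_def trace2_trans)
qed

lemma root_char_mult:
  assumes "g \<in> monics i" "h \<in> monics j"
  shows "root_char f (g * h) = root_char f g * root_char f h"
  using assms monics_nonzero[OF assms(1)] monics_nonzero[OF assms(2)]
  by (simp add: root_char_def root_sum_mult trace2_add root_sum_in_GF2 bit_sign_add)

definition char_sum :: "nat \<Rightarrow> complex" where
  "char_sum n = (\<Sum>g\<in>monics n. root_char f g)"

lemma exp_sum_bit_sign: "exp_sum m f k = (\<Sum>x\<in>GF2 (m * k). bit_sign (q_form m f k x))"
  by (simp add: exp_sum_def bit_sign_def)

text \<open>
  The coefficient form of \<open>T L'(T) = (\<Sum> S\<^sub>k T\<^sup>k) L(T)\<close> for the L-series of the character.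
\<close>

lemma char_sum_recurrence:
  "of_nat n * char_sum n = (\<Sum>k=1..n. exp_sum m f k * char_sum (n - k))"
proof -
  have fin: "finite (GF2 (m * k) :: 'a set)" if "k \<in> {1..n}" for k
    using that m_pos by (intro finite_GF2) (simp add: Suc_le_eq)
  let ?B = "SIGMA g:monics n. SIGMA x:{x. poly g x = 0}. orbit_divisors g x"
  have "(\<Sum>k=1..n. exp_sum m f k * char_sum (n - k)) =
      (\<Sum>k=1..n. \<Sum>(x, h)\<in>GF2 (m * k) \<times> monics (n - k). root_char f (orbit_poly k x * h))"
  proof (rule sum.cong)
    fix k assume "k \<in> {1..n}"
    have "exp_sum m f k * char_sum (n - k) =
      (\<Sum>x\<in>GF2 (m * k). \<Sum>h\<in>monics (n - k). root_char f (orbit_poly k x) * root_char f h)"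
      by (simp add: exp_sum_bit_sign char_sum_def sum_product root_char_orbit_poly)
    also have "\<dots> = (\<Sum>x\<in>GF2 (m * k). \<Sum>h\<in>monics (n - k). root_char f (orbit_poly k x * h))"
      by (intro sum.cong refl) (simp add: root_char_mult[OF orbit_poly_in_monics])
    finally show "exp_sum m f k * char_sum (n - k) =
      (\<Sum>(x, h)\<in>GF2 (m * k) \<times> monics (n - k). root_char f (orbit_poly k x * h))"
      by (simp add: sum.cartesian_product)
  qed simp
  also have "\<dots> = (\<Sum>(k, x, h)\<in>(SIGMA k:{1..n}. GF2 (m * k) \<times> monics (n - k)).
      root_char f (orbit_poly k x * h))"
    by (subst sum.Sigma) (auto simp: fin finite_monics case_prod_unfold)
  also have "\<dots> = (\<Sum>(g, x, k)\<in>?B. root_char f g)"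
    using sum.reindex_bij_betw[OF orbit_divisor_pairs[of n], of "\<lambda>(g, x, k). root_char f g"]
    by (simp add: case_prod_unfold)
  also have "\<dots> = (\<Sum>g\<in>monics n. \<Sum>p\<in>(SIGMA x:{x. poly g x = 0}. orbit_divisors g x). root_char f g)"
  proof (subst sum.Sigma)
    show "\<forall>g\<in>monics n. finite (SIGMA x:{x. poly g x = 0}. orbit_divisors g x)"
      using card_orbit_divisors monics_nonzero
      by (auto simp: monics_def poly_roots_finite intro!: finite_SigmaI)
  qed (auto simp: finite_monics case_prod_unfold)
  also have "\<dots> = (\<Sum>g\<in>monics n. of_nat n * root_char f g)"
  proof (rule sum.cong)
    fix g assume g: "g \<in> monics n"
    hence g': "g \<noteq> 0" "frob g = g" "degree g = n"
      using monics_nonzero by (auto simp: monics_def)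
    have "card (SIGMA x:{x. poly g x = 0}. orbit_divisors g x) =
        (\<Sum>x | poly g x = 0. order x g)"
      using card_orbit_divisors[OF g'(1,2)] poly_roots_finite[OF g'(1)] by simp
    also have "\<dots> = n"
      using sum_order_eq_degree[OF g'(1)] g'(3) by simp
    finally show "(\<Sum>p\<in>(SIGMA x:{x. poly g x = 0}. orbit_divisors g x). root_char f g) =
        of_nat n * root_char f g"
      by simp
  qed simp
  finally show ?thesis
    by (simp add: char_sum_def sum_distrib_left)
qed

lemma char_sum_0: "char_sum 0 = 1"
proof -
  have "monics 0 = {1}"
  proof (intro equalityI subsetI)
    fix g assume "g \<in> monics 0"
    thus "g \<in> {1}" by (auto simp: monics_def elim!: degree_eq_zeroE)
  qed (auto simp: monics_def frob_fix_iff coeff_1)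
  thus ?thesis by (simp add: char_sum_def root_char_def root_sum_def)
qed

text \<open>
  Let \<open>e\<close> be the degree of \<open>f\<close>.  The \<open>e\<close>-th coefficient of \<open>g\<close> from the top enters the power sums
  of the roots of exponent at most \<open>e\<close> only through the summand \<open>e c\<^sub>e\<close> of the \<open>e\<close>-th one.  As \<open>e\<close> is
  odd, changing that coefficient by a suitable \<open>\<delta>\<close> changes the character value by the factor -1, and
  this pairs off the monic polynomials of degree \<open>n\<close>.
\<close>

lemma char_sum_eq_0:
  assumes odd: "odd (degree f)" and n: "n \<ge> degree f"
  shows "char_sum n = 0"
proof -
  define e where "e = degree f"
  have e: "e \<ge> 1" using odd by (auto simp: e_def Suc_le_eq intro: Nat.gr0I)
  have lc: "coeff f e \<noteq> 0" "coeff f e \<in> GF2 m"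
    using odd f_over by (auto simp: e_def)
  obtain \<delta> where \<delta>: "\<delta> \<in> GF2 m" "trace2 m (\<delta> * coeff f e) = 1"
    using trace2_nondegenerate[OF m_pos lc(2,1)] .
  define t where "t g = g + Polynomial.monom \<delta> (n - e)" for g :: "'a poly"
  have en: "e \<le> n" using n by (simp add: e_def)
  have t: "t g \<in> monics n" if g: "g \<in> monics n" for g
  proof -
    have dm: "degree (Polynomial.monom \<delta> (n - e)) < degree g"
      using degree_monom_le[of \<delta> "n - e"] g e en by (auto simp: monics_def)
    hence "degree (t g) = n"
      using g degree_add_eq_left[OF dm] by (simp add: t_def monics_def)
    moreover have "coeff (t g) n = 1"
    proof -
      have "n - e \<noteq> n" using e en by simp
      thus ?thesis using coeff_monic[OF g] by (simp add: t_def coeff_monom)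
    qed
    moreover have "frob (t g) = t g"
      using g \<delta>(1) by (auto simp: frob_fix_iff t_def monics_def coeff_monom GF2_add)
    ultimately show ?thesis by (simp add: monics_def)
  qed
  have tt: "t (t g) = g" for g
    by (simp add: t_def add.assoc add_monom)
  have sums: "(j < e \<longrightarrow> (\<Sum>x\<in>#proots (t g). x ^ j) = (\<Sum>x\<in>#proots g. x ^ j)) \<and>
      (j = e \<longrightarrow> (\<Sum>x\<in>#proots (t g). x ^ j) = (\<Sum>x\<in>#proots g. x ^ j) + of_nat e * \<delta>)"
    if g: "g \<in> monics n" for g j
  proof (induction j rule: less_induct)
    case (less j)
    define c where "c = coeff (reflect_poly g)"
    define c' where "c' = coeff (reflect_poly (t g))"
    have c': "c' i = c i" if "i < e" for i
      using that g t[OF g] en by (simp add: c_def c'_def coeff_reflect_poly monics_def) (simp add: t_def coeff_monom)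
    have c'e: "c' e = c e + \<delta>"
      using g t[OF g] en by (simp add: c_def c'_def coeff_reflect_poly monics_def) (simp add: t_def coeff_monom)
    show ?case
    proof (cases "j = 0 \<or> j > e")
      case True
      thus ?thesis using size_proots_monic[OF g] size_proots_monic[OF t[OF g]] e by auto
    next
      case False
      hence j: "j \<ge> 1" "j \<le> e" by auto
      have "(\<Sum>i=1..<j. (\<Sum>x\<in>#proots (t g). x ^ i) * c' (j - i)) =
            (\<Sum>i=1..<j. (\<Sum>x\<in>#proots g. x ^ i) * c (j - i))"
        using less j by (intro sum.cong refl arg_cong2[where f = "(*)"]) (auto intro!: c')
      thus ?thesis
        using newton_monic[OF g j(1)] newton_monic[OF t[OF g] j(1)] j(2) c'[of j] c'e
        by (auto simp: c_def[symmetric] c'_def[symmetric] uminus_eq distrib_left add_ac)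
    qed
  qed
  have flip: "root_char f (t g) = - root_char f g" if g: "g \<in> monics n" for g
  proof -
    have split: "{..degree f} = insert e {..<e}" by (auto simp: e_def)
    have "root_sum f (t g) = root_sum f g + coeff f e * (of_nat e * \<delta>)"
      unfolding root_sum_power_sums split using sums[OF g] by (simp add: algebra_simps)
    also have "of_nat e = (1 :: 'a)"
    proof -
      obtain k where "e = 2 * k + 1" using odd by (auto simp: e_def elim: oddE)
      thus ?thesis by (simp add: two_eq_0)
    qed
    finally have "root_sum f (t g) = root_sum f g + \<delta> * coeff f e"
      by (simp add: mult.commute)
    thus ?thesis
      using \<delta> lc(2) by (simp add: root_char_def trace2_add root_sum_in_GF2[OF g] GF2_mult bit_sign_add)
  qed
  have "bij_betw t (monics n) (monics n)"
    by (rule bij_betw_byWitness[where f' = t]) (use t tt in auto)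
  hence "char_sum n = (\<Sum>g\<in>monics n. root_char f (t g))"
    unfolding char_sum_def by (rule sum.reindex_bij_betw[symmetric])
  also have "\<dots> = - char_sum n"
    using flip by (simp add: char_sum_def sum_negf)
  finally show ?thesis by simp
qed

text \<open>
  The character sums and \<open>L(f, T)\<close> have the same logarithmic derivative, and the character sums of
  degree at least \<open>degree f\<close> vanish.
\<close>

theorem Lstar_polynomial:
  assumes "odd (degree f)"
  obtains P where "Lstar_fps m f = fps_of_poly P" "coeff P 0 = 1" "degree P < degree f"
    "fps_X * fps_deriv (fps_of_poly P) =
      Abs_fps (\<lambda>n. if n = 0 then 0 else exp_sum m f n / complex_of_real (sqrt 2 ^ (m * n))) * fps_of_poly P"
proof -
  define S where "S = Abs_fps (\<lambda>n. if n = 0 then 0 else exp_sum m f n)"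
  define A where "A = Abs_fps char_sum"
  define c where "c = 1 / complex_of_real (sqrt 2) ^ m"
  have XA: "fps_X * fps_deriv A = S * A"
  proof (rule fps_ext)
    fix n
    have "fps_nth (fps_X * fps_deriv A) n = of_nat n * char_sum n"
      by (cases n) (simp_all add: A_def)
    also have "\<dots> = (\<Sum>k=1..n. exp_sum m f k * char_sum (n - k))"
      by (rule char_sum_recurrence)
    also have "\<dots> = fps_nth (S * A) n"
      by (simp add: fps_mult_nth S_def A_def sum.atLeast_Suc_atMost)
    finally show "fps_nth (fps_X * fps_deriv A) n = fps_nth (S * A) n" .
  qed
  have "L_fps m f = A"
  proof (rule log_deriv_unique)
    let ?B = "Abs_fps (\<lambda>n. if n = 0 then 0 else exp_sum m f n / of_nat n)"
    have "fps_deriv (L_fps m f) = L_fps m f * fps_deriv ?B"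
      unfolding L_fps_def by (subst fps_compose_deriv) simp_all
    moreover have "fps_X * fps_deriv ?B = S"
    proof (rule fps_ext)
      fix n show "fps_nth (fps_X * fps_deriv ?B) n = fps_nth S n"
        by (cases n) (simp_all add: S_def del: of_nat_Suc)
    qed
    ultimately show "fps_X * fps_deriv (L_fps m f) = S * L_fps m f"
      by (simp add: mult.left_commute mult.commute)
    show "fps_nth (L_fps m f) 0 = fps_nth A 0"
      by (simp add: L_fps_def A_def char_sum_0)
    show "fps_nth S 0 = 0"
      by (simp add: S_def)
  qed (rule XA)
  hence L: "fps_nth (Lstar_fps m f) n = c ^ n * char_sum n" for n
    by (simp add: Lstar_fps_def c_def A_def)
  define P where "P = (\<Sum>n<degree f. Polynomial.monom (c ^ n * char_sum n) n)"
  have coeff_P: "coeff P n = c ^ n * char_sum n" for n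
  proof -
    have "coeff P n = (\<Sum>i<degree f. if i = n then c ^ n * char_sum n else 0)"
      unfolding P_def coeff_sum by (intro sum.cong) (auto simp: coeff_monom)
    thus ?thesis using char_sum_eq_0[OF assms, of n] by (auto simp: not_less)
  qed
  have FP: "Lstar_fps m f = fps_of_poly P"
    by (rule fps_ext) (simp add: L coeff_P)
  have pos: "degree f > 0" using assms by (auto intro: Nat.gr0I)
  have "degree P < degree f"
    using pos by (intro degree_lessI) (auto simp: coeff_P char_sum_eq_0[OF assms])
  moreover have "fps_X * fps_deriv (fps_of_poly P) =
      Abs_fps (\<lambda>n. if n = 0 then 0 else exp_sum m f n / complex_of_real (sqrt 2 ^ (m * n))) * fps_of_poly P"
    (is "_ = ?S * _")
  proof (rule fps_ext)
    fix n
    have S: "fps_nth ?S k = c ^ k * fps_nth S k" for k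
      by (simp add: S_def c_def power_divide power_mult)
    have "fps_nth (fps_X * fps_deriv (fps_of_poly P)) n = c ^ n * fps_nth (fps_X * fps_deriv A) n"
      by (cases n) (simp_all add: coeff_P A_def)
    also have "\<dots> = (\<Sum>i=0..n. c ^ n * (fps_nth S i * char_sum (n - i)))"
      unfolding XA by (simp add: fps_mult_nth A_def sum_distrib_left)
    also have "\<dots> = (\<Sum>i=0..n. fps_nth ?S i * coeff P (n - i))"
    proof (rule sum.cong)
      fix i assume "i \<in> {0..n}"
      hence "c ^ n = c ^ i * c ^ (n - i)" by (simp flip: power_add)
      thus "c ^ n * (fps_nth S i * char_sum (n - i)) = fps_nth ?S i * coeff P (n - i)"
        unfolding S coeff_P by (simp only: mult_ac)
    qed simp
    finally show "fps_nth (fps_X * fps_deriv (fps_of_poly P)) n = fps_nth (?S * fps_of_poly P) n"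
      by (simp add: fps_mult_nth)
  qed
  ultimately show ?thesis
    using that[OF FP] by (simp add: coeff_P char_sum_0)
qed

end

end

section \<open>The quadratic exponential sum\<close>

locale quadratic_exp_sum = finite_subfield ty m for ty :: "'a::alg_closed_field itself" and m +
  fixes d :: nat and a :: "nat \<Rightarrow> 'a"
  assumes d_pos: "d \<ge> 1" and coeffs: "\<And>i. i \<le> d \<Longrightarrow> a i \<in> GF2 m" and lead: "a d \<noteq> 0"
begin

abbreviation "f \<equiv> f_poly d a"

lemma coeff_R_poly: "coeff (R_poly d a) j = (\<Sum>i\<le>d. if 2 ^ i = j then a i else 0)"
  unfolding R_poly_def coeff_sum by (intro sum.cong) (auto simp: coeff_monom)

lemma degree_f: "degree f = 2 ^ d + 1"
proof -
  have "coeff (R_poly d a) (2 ^ d) = (\<Sum>i\<le>d. if i = d then a i else 0)"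
    unfolding coeff_R_poly by (intro sum.cong) auto
  hence "coeff (R_poly d a) (2 ^ d) \<noteq> 0" using lead by simp
  moreover have "degree (R_poly d a) \<le> 2 ^ d"
    unfolding R_poly_def
    by (intro degree_sum_le) (auto intro!: order_trans[OF degree_monom_le] power_increasing)
  ultimately have "degree (R_poly d a) = 2 ^ d" "R_poly d a \<noteq> 0"
    by (auto intro: antisym le_degree)
  thus ?thesis by (simp add: f_poly_def)
qed

lemma coeff_f_in_GF2: "coeff f j \<in> GF2 m"
proof -
  have "coeff (R_poly d a) j \<in> GF2 m" for j
    unfolding coeff_R_poly using coeffs by (intro GF2_sum) auto
  thus ?thesis by (simp add: f_poly_def coeff_pCons split: nat.splits)
qed

lemma poly_f: "poly f x = (\<Sum>i\<le>d. a i * (x * x ^ (2 ^ i)))"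
  by (simp add: f_poly_def R_poly_def poly_sum poly_monom sum_distrib_left mult_ac)

text \<open>
  The polynomial \<open>kernel_poly d a\<close> as an additive map.
\<close>

definition kernel_map :: "'a \<Rightarrow> 'a" where
  "kernel_map x = (\<Sum>i\<le>d. a i ^ (2 ^ d) * x ^ (2 ^ (d + i)) + a i ^ (2 ^ (d - i)) * x ^ (2 ^ (d - i)))"

lemma poly_kernel_poly: "poly (kernel_poly d a) x = kernel_map x"
  by (simp add: kernel_poly_def kernel_map_def poly_sum poly_monom)

lemma kernel_map_add: "kernel_map (x + y) = kernel_map x + kernel_map y"
  by (simp add: kernel_map_def power_add_frob distrib_left sum.distrib add_ac)

text \<open>
  Modulo 2 only the term \<open>a\<^sub>d x\<close> survives differentiation, so the kernel polynomial is separable.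
  The two terms with exponent \<open>2 ^ d\<close>, from \<open>i = 0\<close>, cancel, but the leading coefficient is
  \<open>a\<^sub>d ^ (2 ^ d)\<close>.
\<close>

lemma card_kernel: "card {x. kernel_map x = 0} = 2 ^ (2 * d)"
proof -
  let ?K = "kernel_poly d a"
  have pd: "pderiv (Polynomial.monom c (2 ^ j) :: 'a poly) = (if j = 0 then [:c:] else 0)" for c j
    by (simp add: pderiv_monom two_eq_0 monom_0 power_0_left)
  have pd_sum: "pderiv (sum g A) = (\<Sum>i\<in>A. pderiv (g i))" for g :: "nat \<Rightarrow> 'a poly" and A
    by (induction A rule: infinite_finite_induct) (auto simp: pderiv_add)
  have "pderiv ?K = (\<Sum>i\<le>d. if i = d then [:a d:] else 0)"
    unfolding kernel_poly_def pd_sum pderiv_add pd using d_pos by (intro sum.cong) auto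
  hence der: "pderiv ?K = [:a d:]" by simp
  have "coeff ?K (2 ^ (2 * d)) = (\<Sum>i\<le>d. if i = d then a d ^ (2 ^ d) else 0)"
    unfolding kernel_poly_def coeff_sum using d_pos by (intro sum.cong) (auto simp: coeff_monom)
  hence "coeff ?K (2 ^ (2 * d)) \<noteq> 0" using lead by simp
  moreover have "degree ?K \<le> 2 ^ (2 * d)"
    unfolding kernel_poly_def
    by (intro degree_sum_le degree_add_le)
       (auto intro!: order_trans[OF degree_monom_le] power_increasing)
  ultimately have "degree ?K = 2 ^ (2 * d)"
    by (auto intro: antisym le_degree)
  moreover have "card {x. poly ?K x = 0} = degree ?K"
    by (rule card_roots_eq_degree) (simp add: der lead)
  ultimately show ?thesis by (simp add: poly_kernel_poly)
qed

lemma finite_kernel: "finite {x. kernel_map x = 0}"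
  by (rule card_ge_0_finite) (simp add: card_kernel)

definition normalised_sum :: "nat \<Rightarrow> complex" where
  "normalised_sum n = exp_sum m f n / complex_of_real (sqrt 2 ^ (m * n))"

context
  fixes n :: nat
  assumes n: "n \<ge> 1"
begin

lemma mn_pos: "m * n \<ge> 1"
  using m_pos n by (simp add: Suc_le_eq)

lemma a_in: "i \<le> d \<Longrightarrow> a i \<in> GF2 (m * n)"
  using coeffs GF2_mono[of m "m * n"] by auto

lemma kernel_map_in: "x \<in> GF2 (m * n) \<Longrightarrow> kernel_map x \<in> GF2 (m * n)"
  unfolding kernel_map_def by (intro GF2_sum GF2_add GF2_mult GF2_power a_in) auto

lemma poly_f_in: "x \<in> GF2 (m * n) \<Longrightarrow> poly f x \<in> GF2 (m * n)"
  unfolding poly_f by (intro GF2_sum GF2_mult GF2_power a_in) auto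

text \<open>
  The trace is invariant under the Frobenius map.  Raising the two parts of
  \<open>a\<^sub>i (y x ^ (2 ^ i) + x y ^ (2 ^ i))\<close> to the powers \<open>2 ^ d\<close> and \<open>2 ^ (d - i)\<close> makes \<open>y ^ (2 ^ d)\<close> a
  common factor.
\<close>

lemma polarisation_q_form:
  assumes x: "x \<in> GF2 (m * n)" and y: "y \<in> GF2 (m * n)"
  shows "polarisation (q_form m f n) x y = trace2 (m * n) (y ^ (2 ^ d) * kernel_map x)"
proof -
  let ?T = "trace2 (m * n) :: 'a \<Rightarrow> bit"
  note [simp] = GF2_mult GF2_power GF2_add a_in x y
  have f_add: "poly f (x + y) + (poly f x + poly f y) =
      (\<Sum>i\<le>d. a i * (y * x ^ (2 ^ i)) + a i * (x * y ^ (2 ^ i)))"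
  proof -
    have "a i * ((x + y) * (x + y) ^ (2 ^ i)) + (a i * (x * x ^ (2 ^ i)) + a i * (y * y ^ (2 ^ i))) =
        a i * (y * x ^ (2 ^ i)) + a i * (x * y ^ (2 ^ i)) +
        (a i * (x * x ^ (2 ^ i)) + a i * (x * x ^ (2 ^ i))) +
        (a i * (y * y ^ (2 ^ i)) + a i * (y * y ^ (2 ^ i)))" for i
      unfolding power_add_frob by (simp only: algebra_simps)
    hence "a i * ((x + y) * (x + y) ^ (2 ^ i)) + (a i * (x * x ^ (2 ^ i)) + a i * (y * y ^ (2 ^ i))) =
        a i * (y * x ^ (2 ^ i)) + a i * (x * y ^ (2 ^ i))" for i
      by (simp only: add_self add_0_right)
    thus ?thesis
      unfolding poly_f by (simp only: sum.distrib[symmetric])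
  qed
  have "polarisation (q_form m f n) x y = ?T (poly f (x + y) + (poly f x + poly f y))"
    by (simp add: polarisation_def q_form_def trace2_add poly_f_in x y GF2_add add.assoc)
  also have "\<dots> = (\<Sum>i\<le>d. ?T (a i * (y * x ^ (2 ^ i))) + ?T (a i * (x * y ^ (2 ^ i))))"
    unfolding f_add by (subst trace2_sum) (auto intro!: sum.cong trace2_add)
  also have "\<dots> = (\<Sum>i\<le>d. ?T (y ^ (2 ^ d) * (a i ^ (2 ^ d) * x ^ (2 ^ (d + i)))) +
      ?T (y ^ (2 ^ d) * (a i ^ (2 ^ (d - i)) * x ^ (2 ^ (d - i)))))"
  proof (intro sum.cong refl arg_cong2[where f = "(+)"])
    fix i assume i: "i \<in> {..d}"
    have "?T (a i * (y * x ^ (2 ^ i))) = ?T ((a i * (y * x ^ (2 ^ i))) ^ (2 ^ d))"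
      using i by (intro trace2_frob[symmetric]) auto
    also have "(a i * (y * x ^ (2 ^ i))) ^ (2 ^ d) = y ^ (2 ^ d) * (a i ^ (2 ^ d) * x ^ (2 ^ (d + i)))"
      by (simp add: power_mult_distrib power_add mult_ac flip: power_mult)
    finally show "?T (a i * (y * x ^ (2 ^ i))) = ?T (y ^ (2 ^ d) * (a i ^ (2 ^ d) * x ^ (2 ^ (d + i))))" .
    have "?T (a i * (x * y ^ (2 ^ i))) = ?T ((a i * (x * y ^ (2 ^ i))) ^ (2 ^ (d - i)))"
      using i by (intro trace2_frob[symmetric]) auto
    also have "(y ^ (2 ^ i)) ^ (2 ^ (d - i)) = y ^ (2 ^ d)"
      using i by (simp flip: power_mult power_add)
    hence "(a i * (x * y ^ (2 ^ i))) ^ (2 ^ (d - i)) = y ^ (2 ^ d) * (a i ^ (2 ^ (d - i)) * x ^ (2 ^ (d - i)))"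
      by (simp add: power_mult_distrib mult_ac)
    finally show "?T (a i * (x * y ^ (2 ^ i))) = ?T (y ^ (2 ^ d) * (a i ^ (2 ^ (d - i)) * x ^ (2 ^ (d - i))))" .
  qed
  also have "\<dots> = (\<Sum>i\<le>d. ?T (y ^ (2 ^ d) * (a i ^ (2 ^ d) * x ^ (2 ^ (d + i)) +
      a i ^ (2 ^ (d - i)) * x ^ (2 ^ (d - i)))))"
    unfolding distrib_left by (intro sum.cong refl trace2_add[symmetric]) auto
  also have "\<dots> = ?T (y ^ (2 ^ d) * kernel_map x)"
    unfolding kernel_map_def sum_distrib_left by (rule trace2_sum[symmetric]) auto
  finally show ?thesis .
qed

lemma quadratic_space_q_form: "quadratic_space (GF2 (m * n)) (q_form m f n)"
proof
  fix x y z :: 'a assume xyz: "x \<in> GF2 (m * n)" "y \<in> GF2 (m * n)" "z \<in> GF2 (m * n)"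
  show "polarisation (q_form m f n) (x + y) z = polarisation (q_form m f n) x z + polarisation (q_form m f n) y z"
    using xyz by (simp add: polarisation_q_form GF2_add kernel_map_add distrib_left)
      (intro trace2_add GF2_mult GF2_power kernel_map_in)
qed (simp_all add: finite_GF2[OF mn_pos] GF2_add)

text \<open>
  The trace form is nondegenerate and \<open>y \<mapsto> y ^ (2 ^ d)\<close> is bijective, so the polarisation vanishes
  identically in \<open>y\<close> only at the zeros of the kernel polynomial.
\<close>

lemma radical_q_form:
  "radical (GF2 (m * n)) (q_form m f n) = {x \<in> GF2 (m * n). kernel_map x = 0}"
proof (intro equalityI subsetI)
  fix x assume "x \<in> radical (GF2 (m * n)) (q_form m f n)"
  hence x: "x \<in> GF2 (m * n)"
    and rad: "\<And>y. y \<in> GF2 (m * n) \<Longrightarrow> polarisation (q_form m f n) x y = 0"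
    by (auto simp: radical_def)
  have "kernel_map x = 0"
  proof (rule ccontr)
    assume "kernel_map x \<noteq> 0"
    then obtain y where y: "y \<in> GF2 (m * n)" "trace2 (m * n) (y * kernel_map x) = 1"
      using trace2_nondegenerate[OF mn_pos kernel_map_in[OF x]] by blast
    obtain z where z: "z \<in> GF2 (m * n)" "y = z ^ (2 ^ d)"
      using bij_betw_frob_GF2[OF mn_pos, of d] y(1) by (auto simp: bij_betw_def)
    show False
      using rad[OF z(1)] polarisation_q_form[OF x z(1)] y(2) z(2) by simp
  qed
  thus "x \<in> {x \<in> GF2 (m * n). kernel_map x = 0}" using x by simp
next
  fix x assume "x \<in> {x \<in> GF2 (m * n). kernel_map x = 0}"
  thus "x \<in> radical (GF2 (m * n)) (q_form m f n)"
    by (simp add: radical_def polarisation_q_form)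
qed

text \<open>
  Writing \<open>c\<close> for the dimension of the radical, \<open>S\<^sub>n = \<epsilon>\<^sub>n 2 ^ ((mn + c) / 2)\<close>, and the factor
  \<open>2 ^ (mn / 2)\<close> is removed by the normalisation.
\<close>

lemma normalised_sum_cases:
  obtains (zero) x where "eps m f n = 0" "normalised_sum n = 0"
      "x \<in> GF2 (m * n)" "kernel_map x = 0" "q_form m f n x \<noteq> 0"
  | (nonzero) c where "eps m f n = 1 \<or> eps m f n = -1"
      "normalised_sum n = of_int (eps m f n) * complex_of_real (sqrt 2 ^ c)"
      "card {x \<in> GF2 (m * n). kernel_map x = 0} = 2 ^ c" "c \<le> 2 * d"
proof -
  interpret quadratic_space "GF2 (m * n)" "q_form m f n"
    by (rule quadratic_space_q_form)
  have gs: "exp_sum m f n = gauss_sum (GF2 (m * n)) (q_form m f n)"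
    by (simp add: exp_sum_def gauss_sum_def bit_sign_def)
  show ?thesis
  proof (cases rule: eps_form_gauss_sum)
    case (degenerate x)
    thus ?thesis
      using zero[of x] by (simp add: eps_def normalised_sum_def gs radical_q_form)
  next
    case (nondegenerate c t)
    have "(2::nat) ^ (m * n) = 2 ^ (c + 2 * t)"
      using nondegenerate(2) card_GF2[OF mn_pos] by simp
    hence mn: "m * n = c + 2 * t" by simp
    have "(sqrt 2 ^ c * sqrt 2 ^ (c + 2 * t) :: real) = (sqrt 2 ^ 2) ^ (c + t)"
      by (simp only: power_mult[symmetric] power_add[symmetric]) (simp add: algebra_simps)
    hence "(2 :: real) ^ (c + t) = sqrt 2 ^ c * sqrt 2 ^ (c + 2 * t)" by simp
    hence "(2 :: complex) ^ (c + t) = complex_of_real (sqrt 2 ^ c * sqrt 2 ^ (c + 2 * t))"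
      by (metis of_real_numeral of_real_power)
    hence "normalised_sum n = of_int (eps m f n) * complex_of_real (sqrt 2 ^ c)"
      using nondegenerate(5) by (simp add: normalised_sum_def gs mn eps_def)
    moreover have card: "card {x \<in> GF2 (m * n). kernel_map x = 0} = 2 ^ c"
      using nondegenerate(3) radical_q_form by simp
    moreover have "(2::nat) ^ c \<le> 2 ^ (2 * d)"
      unfolding card[symmetric] card_kernel[symmetric] by (intro card_mono finite_kernel) auto
    hence "c \<le> 2 * d" by simp
    ultimately show ?thesis
      using nonzero[of c] nondegenerate(4) by (simp add: eps_def)
  qed
qed

lemma sqrt_2_power_even: "sqrt 2 ^ (2 * d) = (2 :: real) ^ d"
  by (simp add: power_mult)

lemma norm_normalised_sum_le: "norm (normalised_sum n) \<le> 2 ^ d"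
proof (cases rule: normalised_sum_cases)
  case (nonzero c)
  have "sqrt 2 ^ c \<le> sqrt 2 ^ (2 * d)"
    using nonzero(4) by (intro power_increasing) auto
  thus ?thesis
    using nonzero(1,2) unfolding sqrt_2_power_even by (auto simp: norm_mult norm_power)
qed simp

text \<open>
  The radical consists of the zeros of the kernel polynomial in the field at hand, so its size is
  maximal exactly if all these zeros are there.
\<close>

lemma normalised_sum_maximal_iff:
  "norm (normalised_sum n) = 2 ^ d \<longleftrightarrow> eps m f n \<noteq> 0 \<and> {x. kernel_map x = 0} \<subseteq> GF2 (m * n)"
proof (cases rule: normalised_sum_cases)
  case (nonzero c)
  have "norm (normalised_sum n) = 2 ^ d \<longleftrightarrow> sqrt 2 ^ c = (sqrt 2 ^ (2 * d) :: real)"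
    using nonzero(1,2) unfolding sqrt_2_power_even by (auto simp: norm_mult norm_power)
  also have "\<dots> \<longleftrightarrow> c = 2 * d"
    by (rule power_inject_exp) simp
  also have "\<dots> \<longleftrightarrow> card {x \<in> GF2 (m * n). kernel_map x = 0} = card {x. kernel_map x = 0}"
    unfolding nonzero(3) card_kernel by simp
  also have "\<dots> \<longleftrightarrow> {x \<in> GF2 (m * n). kernel_map x = 0} = {x. kernel_map x = 0}"
    using card_subset_eq[OF finite_kernel, of "{x \<in> GF2 (m * n). kernel_map x = 0}"] by fastforce
  finally show ?thesis using nonzero(1) by auto
qed simp

lemma normalised_sum_kernel_split:
  assumes "{x. kernel_map x = 0} \<subseteq> GF2 (m * n)"
  shows "normalised_sum n = of_int (eps m f n) * 2 ^ d"
proof (cases rule: normalised_sum_cases)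
  case (nonzero c)
  have "norm (normalised_sum n) = 2 ^ d"
    using normalised_sum_maximal_iff assms nonzero(1) by auto
  hence "(sqrt 2 ^ c :: real) = 2 ^ d"
    using nonzero(1,2) by (auto simp: norm_mult norm_power)
  hence "complex_of_real (sqrt 2 ^ c) = 2 ^ d"
    by simp
  thus ?thesis using nonzero(2) by simp
qed simp

lemma eps_range: "eps m f n \<in> {-1, 0, 1}"
  by (cases rule: normalised_sum_cases) auto

end

text \<open>
  If all zeros of the kernel polynomial lie in the extension of degree \<open>n\<close>, then the radical does not
  grow in the extension of degree \<open>2 * n\<close>, and there the form vanishes on it by \<open>trace2_double\<close>.
\<close>

lemma eps_double_nonzero:
  assumes "n \<ge> 1" "{x. kernel_map x = 0} \<subseteq> GF2 (m * n)"
  shows "eps m f (2 * n) \<noteq> 0"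
proof
  assume eps0: "eps m f (2 * n) = 0"
  have n2: "2 * n \<ge> 1" using assms(1) by simp
  from eps0 obtain x where x: "kernel_map x = 0" "q_form m f (2 * n) x \<noteq> 0"
    by (cases rule: normalised_sum_cases[OF n2]) auto
  have "poly f x \<in> GF2 (m * n)"
    using x(1) assms by (intro poly_f_in) auto
  hence "trace2 (m * n * 2) (poly f x) = 0"
    by (rule trace2_double)
  thus False using x(2) by (simp add: q_form_def mult_ac)
qed

end

section \<open>Comparison of the two descriptions of the exponential sums\<close>

theorem proposition3p8:
  fixes m d N D :: nat
    and a :: "nat \<Rightarrow> 'a::alg_closed_field"
    and f :: "'a poly"
  assumes char2: "CHAR('a) = 2"
    and m: "m \<ge> 1" and d: "d \<ge> 1"
    and coeffs: "\<And>i. i \<le> d \<Longrightarrow> a i \<in> GF2 m"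
    and lead: "a d \<noteq> 0"
    and f: "f = f_poly d a"
    and N: "N \<ge> 1" "splitting_field (GF2 m) (kernel_poly d a) = GF2 (m * N)"
    and D: "D = L_period m f"
  shows "D \<in> {N, 2 * N, 4 * N} \<and>
    (eps m f N = -1 \<longrightarrow> D = N) \<and>
    (eps m f N = 1 \<longrightarrow>
       eps m f (2 * N) = -1 \<and> D = 2 * N \<and>
       (\<forall>\<beta> \<in> reciprocal_roots (Lstar_fps m f).
          multiplicity 2 (unity_order \<beta>) = multiplicity 2 N + 1)) \<and>
    (eps m f N = 0 \<longrightarrow>
       (eps m f (2 * N) = -1 \<and> D = 2 * N) \<or>
       (eps m f (2 * N) = 1 \<and> D = 4 * N \<and>
        (\<forall>\<beta> \<in> reciprocal_roots (Lstar_fps m f).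
           multiplicity 2 (unity_order \<beta>) = multiplicity 2 N + 2)))"
proof -
  interpret quadratic_exp_sum "TYPE('a)" m d a
    by unfold_locales (use char2 m d coeffs lead in auto)
  define s where "s n = normalised_sum n" for n
  \<comment> \<open>Containing the zeros means containing the splitting field, and inclusions of finite fields correspond to divisibility of degrees.\<close>
  have split_iff: "{x. kernel_map x = 0} \<subseteq> GF2 (m * n) \<longleftrightarrow> N dvd n" if "n \<ge> 1" for n
  proof
    assume "{x. kernel_map x = 0} \<subseteq> GF2 (m * n)"
    hence "GF2 (m * N) \<subseteq> (GF2 (m * n) :: 'a set)"
      using splitting_field_subset_iff[of m "m * n" "kernel_poly d a"] N(2)
      by (simp add: poly_kernel_poly)
    hence "m * N dvd m * n"
      using m N(1) that by (intro GF2_subset_imp_dvd) (simp_all add: Suc_le_eq)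
    thus "N dvd n" using m by simp
  next
    assume "N dvd n"
    hence "GF2 (m * N) \<subseteq> (GF2 (m * n) :: 'a set)"
      by (intro GF2_mono) simp
    moreover have "{x. kernel_map x = 0} \<subseteq> GF2 (m * N)"
      using splitting_field_subset_iff[of m "m * N" "kernel_poly d a"] N(2)
      by (simp add: poly_kernel_poly)
    ultimately show "{x. kernel_map x = 0} \<subseteq> GF2 (m * n)" by blast
  qed
  have "odd (degree (f_poly d a))"
    using d by (simp add: degree_f)
  then obtain P where P: "Lstar_fps m f = fps_of_poly P" "coeff P 0 = 1" "degree P < 2 ^ d + 1"
    "fps_X * fps_deriv (fps_of_poly P) = Abs_fps (\<lambda>n. if n = 0 then 0 else s n) * fps_of_poly P"
    unfolding f s_def normalised_sum_def degree_f[symmetric]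
    by (rule Lstar_polynomial[OF coeff_f_in_GF2])
  obtain B where B: "P = (\<Prod>b\<in>#B. [:1, -b:])" "size B = degree P" "0 \<notin># B"
    using reciprocal_factorization[OF P(2)] .
  have roots: "reciprocal_roots (Lstar_fps m f) = set_mset B"
    using reciprocal_roots_prod[OF B(3)] by (simp add: P(1) B(1))
  have s: "(\<Sum>b\<in>#B. b ^ n) = - s n" if "n \<ge> 1" for n
    using power_sums_from_log_deriv[of B s n] P(4) that by (simp add: B(1))
  have size_B: "size B \<le> 2 ^ d"
    using P(3) B(2) by simp
  have norm_b: "norm b \<le> 1" if "b \<in># B" for b
    by (rule bounded_power_sums_imp_norm_le_1[OF _ that, of "2 ^ d"])
       (simp add: s s_def norm_normalised_sum_le)
  \<comment> \<open>An extremal exponential sum pins down the \<open>n\<close>-th power of every reciprocal root.\<close>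
  have powers: "\<forall>b\<in>#B. b ^ n = - of_int (eps m f n)"
    if n: "n \<ge> 1" "N dvd n" "eps m f n = 1 \<or> eps m f n = -1" for n
  proof (rule extremal_sum_imp_all_eq)
    show "(\<Sum>b\<in>#B. b ^ n) = of_nat (2 ^ d) * - of_int (eps m f n)"
    proof -
      have "normalised_sum n = of_int (eps m f n) * 2 ^ d"
        unfolding f using n(2) split_iff[OF n(1)] by (intro normalised_sum_kernel_split[OF n(1)]) blast
      thus ?thesis by (simp only: s[OF n(1)] s_def) simp
    qed
  qed (use n norm_b size_B in \<open>auto simp: norm_power power_le_one\<close>)
  have sum_1: "s n = - of_nat (size B)" if "n \<ge> 1" "\<forall>b\<in>#B. b ^ n = 1" for n
  proof -
    have "(\<Sum>b\<in>#B. b ^ n) = (\<Sum>b\<in>#B. 1)"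
      using that(2) by (intro arg_cong[where f = sum_mset] image_mset_cong) auto
    hence "- s n = of_nat (size B)" using s[OF that(1)] by simp
    thus ?thesis by (simp only: minus_equation_iff[of "s n"])
  qed
  have eps_cases: "eps m f n = -1 \<or> eps m f n = 0 \<or> eps m f n = 1" if "n \<ge> 1" for n
    using eps_range[OF that] by (auto simp: f)
  have N2: "2 * N \<ge> 1" using N(1) by simp
  have eps_2N: "eps m f (2 * N) \<noteq> 0"
    using eps_double_nonzero[OF N(1)] split_iff[OF N(1)] by (simp add: f)
  \<comment> \<open>One of the sums, the one for \<open>2 * N\<close>, is extremal, so there are \<open>2 ^ d\<close> reciprocal roots.\<close>
  have "\<exists>n\<ge>1. norm (s n) = 2 ^ d"
    using normalised_sum_maximal_iff[OF N2] split_iff[OF N2] eps_2N N2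
    by (intro exI[of _ "2 * N"]) (simp add: s_def f)
  then obtain n0 where n0: "n0 \<ge> 1" "norm (s n0) = 2 ^ d" by blast
  have size_eq: "size B = 2 ^ d"
  proof -
    have "norm (\<Sum>b\<in>#A. b ^ n0) \<le> real (size A)" if "A \<subseteq># B" for A
      using that
    proof (induction A)
      case (add b A)
      hence "b \<in># B" "A \<subseteq># B"
        by (auto dest: mset_subset_eq_insertD simp: subset_mset.less_imp_le)
      moreover from this have "norm (b ^ n0) \<le> 1"
        using norm_b by (simp add: norm_power power_le_one)
      ultimately show ?case
        using add.IH norm_triangle_ineq[of "b ^ n0" "\<Sum>b\<in>#A. b ^ n0"] by simp
    qed simp
    from this[OF subset_mset.order_refl] have "norm (s n0) \<le> real (size B)"
      unfolding s[OF n0(1)] norm_minus_cancel .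
    hence "real (2 ^ d) \<le> real (size B)" using n0(2) by simp
    thus ?thesis using size_B by linarith
  qed
  obtain b where b: "b \<in># B"
    using size_eq by (cases "B = {#}") (auto dest: multiset_nonemptyE)
  \<comment> \<open>If all \<open>n\<close>-th powers are 1, the sum is extremal, so every period is a multiple of \<open>N\<close>.\<close>
  have N_dvd: "N dvd n" if "n \<ge> 1" "\<forall>b\<in>#B. b ^ n = 1" for n
  proof -
    have "norm (s n) = 2 ^ d" using sum_1[OF that] size_eq by (simp add: norm_power)
    thus ?thesis
      using normalised_sum_maximal_iff[OF that(1)] split_iff[OF that(1)] by (simp add: s_def)
  qed
  have period: "D dvd n \<longleftrightarrow> (\<forall>b\<in>#B. b ^ n = 1)" if "k \<ge> 1" "\<forall>b\<in>#B. b ^ k = 1" for k n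
    unfolding D L_period_def roots by (rule Lcm_unity_order_dvd_iff[of k]) (use that in auto)
  have N_dvd_D: "N dvd D \<and> D \<ge> 1" if k: "k \<ge> 1" "\<forall>b\<in>#B. b ^ k = 1" for k
  proof -
    have "D dvd k" using period[OF k] k by simp
    hence D1: "D \<ge> 1" using k(1) by (auto intro: Nat.gr0I simp: Suc_le_eq)
    moreover have "\<forall>b\<in>#B. b ^ D = 1" using period[OF k, of D] by simp
    ultimately show ?thesis using N_dvd[of D] by simp
  qed
  have ord: "multiplicity 2 (unity_order \<beta>) = multiplicity 2 n + 1"
    if "n \<ge> 1" "\<forall>b\<in>#B. b ^ n = -1" "\<beta> \<in> reciprocal_roots (Lstar_fps m f)" for n \<beta>
    using multiplicity_unity_order[of n \<beta>] that roots by auto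
  have D_cases: "D = N \<or> D = 2 * N" if ND: "N dvd D" "D dvd 2 * N"
  proof -
    obtain k where k: "D = N * k" using ND(1) by (elim dvdE)
    hence "k dvd 2" using ND(2) N(1) by (simp add: mult.commute)
    hence "k = 1 \<or> k = 2" using dvd_imp_le[of k 2] by (cases k) (auto simp: le_Suc_eq)
    thus ?thesis using k by auto
  qed
  have minus: "D = N" if "eps m f N = -1"
  proof -
    have one: "\<forall>b\<in>#B. b ^ N = 1" using powers[OF N(1)] that by simp
    show ?thesis
      using period[OF N(1) one, of N] N_dvd_D[OF N(1) one] one by (simp add: dvd_antisym)
  qed
  have plus: "eps m f (2 * N) = -1 \<and> D = 2 * N \<and> (\<forall>b\<in>#B. b ^ N = -1)" if "eps m f N = 1"
  proof -
    have m1: "\<forall>b\<in>#B. b ^ N = -1" using powers[OF N(1)] that by simp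
    hence one: "\<forall>b\<in>#B. b ^ (2 * N) = 1" by (simp add: power_mult mult.commute[of 2])
    have "eps m f (2 * N) \<noteq> 1"
      using powers[OF N2] one b by auto
    hence e: "eps m f (2 * N) = -1"
      using eps_cases[OF N2] eps_2N by auto
    have "\<not> D dvd N"
      using period[OF N2 one, of N] m1 b by auto
    hence "D = 2 * N"
      using D_cases N_dvd_D[OF N2 one] period[OF N2 one, of "2 * N"] one by auto
    thus ?thesis using e m1 by simp
  qed
  have zero_minus: "D = 2 * N" if "eps m f N = 0" "eps m f (2 * N) = -1"
  proof -
    have one: "\<forall>b\<in>#B. b ^ (2 * N) = 1" using powers[OF N2] that by simp
    have "s N = 0"
      using normalised_sum_kernel_split[OF N(1)] split_iff[OF N(1)] that(1) by (simp add: s_def f)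
    hence "\<not> D dvd N"
      using period[OF N2 one, of N] sum_1[OF N(1)] size_eq by auto
    thus ?thesis
      using D_cases N_dvd_D[OF N2 one] period[OF N2 one, of "2 * N"] one by auto
  qed
  have zero_plus: "D = 4 * N \<and> (\<forall>b\<in>#B. b ^ (2 * N) = -1)" if "eps m f (2 * N) = 1"
  proof -
    have m1: "\<forall>b\<in>#B. b ^ (2 * N) = -1" using powers[OF N2] that by simp
    have one: "\<forall>b\<in>#B. b ^ (4 * N) = 1"
    proof
      fix b assume "b \<in># B"
      hence "(b ^ (2 * N)) ^ 2 = 1" using m1 by simp
      thus "b ^ (4 * N) = 1" by (simp add: mult_ac flip: power_mult)
    qed
    have N4: "4 * N \<ge> 1" using N(1) by simp
    have nd: "\<not> D dvd 2 * N"
      using period[OF N4 one, of "2 * N"] m1 b by auto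
    have D4: "D dvd 4 * N" using period[OF N4 one, of "4 * N"] one by simp
    obtain k where k: "D = N * k" using N_dvd_D[OF N4 one] by (auto elim: dvdE)
    have "k dvd 4" "\<not> k dvd 2" using D4 nd k N(1) by (simp_all add: mult.commute)
    hence "k = 4"
      using dvd_imp_le[of k 4] by (cases "k = 0 \<or> k = 1 \<or> k = 2 \<or> k = 3") (auto simp: le_Suc_eq)
    thus ?thesis using k m1 by simp
  qed
  have two: "multiplicity 2 (2 * N) = multiplicity 2 N + 1"
    using N(1) by (subst multiplicity_times_same) auto
  show ?thesis
    using eps_cases[OF N(1)] eps_cases[OF N2] eps_2N minus plus zero_minus zero_plus
      ord[OF N(1)] ord[OF N2] two by auto
qed

end
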